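(* The trivial packing is optimal for packing $22$ unit squares in a square, and $s(22)=5$.
   Context: For a positive integer $n$, $s(n)$ denotes the side length of the smallest square into which $n$ non-overlapping unit squares can be packed. Here all squares are in the Euclidean plane; unit squares (closed squares of side length $1$) may be placed in arbitrary position and with arbitrary orientation (rotations are allowed); they are non-overlapping if their interiors are pairwise disjoint; and they are packed in a (closed) square $S$ if each of them is a subset of $S$. The trivial (or "chess board") packing of $22$ unit squares places them in $22$ distinct cells of the $5\times 5$ grid of unit cells subdividing a square of side length $5$; it is optimal if no square of smaller side length admits a packing of $22$ non-overlapping unit squares. *)

theory Defs
  imports "HOL-Analysis.Analysis"
begin

type_synonym point = "real ^ 2"

definition orthonormal :: "point \<Rightarrow> point \<Rightarrow> bool" where
  "orthonormal u v \<longleftrightarrow> norm u = 1 \<and> norm v = 1 \<and> u \<bullet> v = 0"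

text \<open>For orthonormal \<open>u\<close> and \<open>v\<close>, this is the closed square with corner \<open>c\<close>, side length \<open>a\<close>
  and sides in the directions \<open>u\<close> and \<open>v\<close>.\<close>

definition frame_square :: "point \<Rightarrow> point \<Rightarrow> point \<Rightarrow> real \<Rightarrow> point set" where
  "frame_square c u v a = {c + x *\<^sub>R u + y *\<^sub>R v | x y. x \<in> {0..a} \<and> y \<in> {0..a}}"

definition is_square :: "real \<Rightarrow> point set \<Rightarrow> bool" where
  "is_square a S \<longleftrightarrow> a > 0 \<and> (\<exists>c u v. orthonormal u v \<and> S = frame_square c u v a)"

text \<open>A packing is given as a set of squares. No multiplicities are lost: two non-overlapping unit
  squares are distinct sets, since their interiors are nonempty.\<close>

definition packing :: "nat \<Rightarrow> point set set \<Rightarrow> point set \<Rightarrow> bool" where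
  "packing n \<Q> S \<longleftrightarrow>
     finite \<Q> \<and> card \<Q> = n \<and>
     (\<forall>Q\<in>\<Q>. is_square 1 Q \<and> Q \<subseteq> S) \<and>
     pairwise (\<lambda>P Q. interior P \<inter> interior Q = {}) \<Q>"

definition packable :: "nat \<Rightarrow> real \<Rightarrow> bool" where
  "packable n a \<longleftrightarrow> (\<exists>S \<Q>. is_square a S \<and> packing n \<Q> S)"

text \<open>The number \<open>s(n)\<close>, for positive \<open>n\<close>. \<open>Least\<close> on the reals is meaningful only if a minimum
  exists.\<close>

definition packing_side :: "nat \<Rightarrow> real" where
  "packing_side n = (LEAST a. packable n a)"

definition optimal_packing :: "nat \<Rightarrow> real \<Rightarrow> point set set \<Rightarrow> point set \<Rightarrow> bool" where
  "optimal_packing n a \<Q> S \<longleftrightarrow>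
     is_square a S \<and> packing n \<Q> S \<and> (\<forall>b<a. \<not> packable n b)"

definition grid_cells :: "nat \<Rightarrow> point \<Rightarrow> point \<Rightarrow> point \<Rightarrow> point set set" where
  "grid_cells k c u v =
     {frame_square (c + real i *\<^sub>R u + real j *\<^sub>R v) u v 1 | i j. i < k \<and> j < k}"

text \<open>\<open>\<Q>\<close> consists of \<open>n\<close> distinct cells of the \<open>k \<times> k\<close> grid subdividing the square \<open>S\<close> of side
  length \<open>k\<close>. Neither the position of \<open>S\<close> nor the choice of the cells is fixed.\<close>

definition trivial_packing :: "nat \<Rightarrow> nat \<Rightarrow> point set set \<Rightarrow> point set \<Rightarrow> bool" where
  "trivial_packing n k \<Q> S \<longleftrightarrow>
     (\<exists>c u v. orthonormal u v \<and> S = frame_square c u v (real k) \<and>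
        \<Q> \<subseteq> grid_cells k c u v \<and> finite \<Q> \<and> card \<Q> = n)"

end

theory Submission
  imports Defs
begin

text \<open>Suppose that 22 unit squares are packed in a square of side less than 5. After scaling, they become
  22 disjoint open squares (``boxes'') of side slightly larger than 1 in the square \<open>[0, 5]\<^sup>2\<close>. A triangular
  arrangement of 22 points in rows of 4, 5, 4, 5, 4 points, with spacing 1 and row gap slightly less than half the
  square root of 3, is unavoidable: every such box contains one of the points, and this remains true while
  the rows slide vertically through a certain range. Since there are as many boxes as points, each box contains
  exactly one point at any time, and by continuity always the same one, so it contains the whole path of that
  point. Knowing this, the range of the sliding can be extended. The same holds for the transposed
  arrangement in columns, so every box is labelled by a point of a row and a point of a column. Boxes
  have diameter less than 1.45, which leaves few possibilities for the pairs of labels. Either a corner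
  box contains the points next to the corner in the row and the column crosswise, which forces two boxes
  to overlap, or the pairing is determined up to the four central boxes, two of which then contain the
  centre of the square.\<close>

section \<open>Boxes\<close>

text \<open>The obstacle: a box tilted by 45 degrees and standing on the bottom side has its top
  corner at height about sqrt 2 and can push it between two points at distance 1 once these lie
  higher than sqrt 2 - 1/2. Hence the bare arrangement serves only up to
  \<open>t = 914 / 1000\<close> and, by reflection, from \<open>622 / 1000\<close> on. Beyond that,
  a box is stopped not by two points at the current height but by the segments which they have
  already swept, one of which it contains while the other it avoids. The longer the segments, the
  sharper the distance test for pairs of labels and the linear inequalities for single boxes. The
  direction \<open>(c, s)\<close> is kept as a pair of unknowns on the unit circle. Membership is
  then linear in \<open>k\<close> and \<open>m\<close>; eliminating these leaves inequalities in the
  angle alone, settled through \<open>w = c + s\<close>, where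
  \<open>c * s = (w * w - 1) / 2\<close>, or through the tangent of the half angle.\<close>

text \<open>\<open>inb r c s k m\<close> is the open square of side \<open>r\<close> with sides in the directions \<open>(c, s)\<close> and \<open>(-s, c)\<close>, one
  corner having the coordinates \<open>k\<close> and \<open>m\<close> in this frame. The last four conditions of \<open>fitting\<close>
  say that its leftmost, rightmost, lowest and highest vertices stay within the square \<open>[0, 5]\<^sup>2\<close>.\<close>

definition inb :: "real \<Rightarrow> real \<Rightarrow> real \<Rightarrow> real \<Rightarrow> real \<Rightarrow> real \<Rightarrow> real \<Rightarrow> bool" where
  "inb r c s k m a b \<longleftrightarrow> k < a * c + b * s \<and> a * c + b * s < k + r \<and>
     m < b * c - a * s \<and> b * c - a * s < m + r"

definition fitting :: "real \<Rightarrow> real \<Rightarrow> real \<Rightarrow> real \<Rightarrow> real \<Rightarrow> bool" where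
  "fitting r c s k m \<longleftrightarrow> 1 < r \<and> r < (1001 / 1000) \<and> 0 \<le> c \<and> 0 \<le> s \<and> c * c + s * s = 1 \<and>
     0 \<le> k * c - (m + r) * s \<and> (k + r) * c - m * s \<le> 5 \<and>
     0 \<le> k * s + m * c \<and> (k + r) * s + (m + r) * c \<le> 5"

definition cenx :: "real \<Rightarrow> real \<Rightarrow> real \<Rightarrow> real \<Rightarrow> real \<Rightarrow> real" where
  "cenx r c s k m = (k + r / 2) * c - (m + r / 2) * s"

definition ceny :: "real \<Rightarrow> real \<Rightarrow> real \<Rightarrow> real \<Rightarrow> real \<Rightarrow> real" where
  "ceny r c s k m = (k + r / 2) * s + (m + r / 2) * c"

section \<open>Reflections of boxes and elementary facts on angles\<close>

lemma inb_swap: "inb r s c k (- m - r) b a \<longleftrightarrow> inb r c s k m a b"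
  by (auto simp: inb_def algebra_simps)

lemma fitting_swap: "fitting r c s k m \<Longrightarrow> fitting r s c k (- m - r)"
  by (auto simp: fitting_def algebra_simps)

lemma cenx_swap: "cenx r s c k (- m - r) = ceny r c s k m"
  by (simp add: cenx_def ceny_def field_simps)

lemma ceny_swap: "ceny r s c k (- m - r) = cenx r c s k m"
  by (simp add: cenx_def ceny_def field_simps)

text \<open>A reflection reverses orientation, so the sides of the frame have to be renamed;
  exchanging \<open>c\<close> and \<open>s\<close> keeps the direction in the first quadrant, and
  the class of boxes is closed under reflections.\<close>

lemma inb_reflx: "inb r s c (5 * s + m) (k - 5 * c) (5 - a) b \<longleftrightarrow> inb r c s k m a b"
  by (auto simp: inb_def algebra_simps)

lemma fitting_reflx:
  assumes a: "fitting r c s k m"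
  shows "fitting r s c (5 * s + m) (k - 5 * c)"
proof -
  have "c * c + s * s = 1" using a by (simp add: fitting_def)
  then have *: "c * (c * 5) + s * (s * 5) = 5" by (simp add: algebra_simps)
  show ?thesis using a unfolding fitting_def by (auto simp: algebra_simps *)
qed

lemma cenx_reflx:
  assumes "c * c + s * s = 1"
  shows "cenx r s c (5 * s + m) (k - 5 * c) = 5 - cenx r c s k m"
proof -
  have "cenx r s c (5 * s + m) (k - 5 * c) = 5 * (c * c + s * s) - cenx r c s k m"
    by (simp add: cenx_def field_simps)
  then show ?thesis using assms by simp
qed

lemma ceny_reflx: "ceny r s c (5 * s + m) (k - 5 * c) = ceny r c s k m"
  by (simp add: ceny_def field_simps)

text \<open>\<open>141422 / 100000\<close> is sqrt 2 rounded up. The sum \<open>c + s\<close> is the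
  width and the height of a unit square turned into this direction.\<close>

lemma trig_pair:
  fixes c s :: real
  assumes "0 \<le> c" "0 \<le> s" "c * c + s * s = 1"
  shows "c \<le> 1" "s \<le> 1" "1 \<le> c + s" "c + s < (141422 / 100000)" "2 * (c * s) \<le> 1"
proof -
  show c: "c \<le> 1" and s: "s \<le> 1" using assms by (smt (verit) mult_le_one mult_less_cancel_left1 mult_nonneg_nonneg)+
  have "c * c \<le> c" "s * s \<le> s" using c s assms by (simp_all add: mult_left_le)
  then show "1 \<le> c + s" using assms by linarith
  have "0 \<le> (c - s) * (c - s)" by simp
  then show cs: "2 * (c * s) \<le> 1" using assms by (simp add: algebra_simps)
  have "(c + s)\<^sup>2 < (141422 / 100000)\<^sup>2" using cs assms by (simp add: power2_eq_square algebra_simps)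
  then show "c + s < (141422 / 100000)" by (rule power2_less_imp_less) simp
qed

text \<open>Rational parametrisation of the quarter circle by the tangent of the half angle; it
  turns inequalities in \<open>c\<close> and \<open>s\<close> into polynomial ones on the unit
  interval.\<close>

lemma half_angle:
  fixes c s :: real
  assumes "0 \<le> c" "0 \<le> s" "c * c + s * s = 1"
  obtains z where "0 \<le> z" "z \<le> 1" "c = (1 - z\<^sup>2) / (1 + z\<^sup>2)" "s = 2 * z / (1 + z\<^sup>2)"
proof
  let ?z = "s / (1 + c)"
  show "0 \<le> ?z" using assms by simp
  show "?z \<le> 1" using trig_pair[OF assms] assms by simp
  have n: "1 + c \<noteq> 0" using assms by simp
  have s2: "s\<^sup>2 = (1 - c) * (1 + c)" using assms(3) by (simp add: power2_eq_square algebra_simps)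
  have z2: "?z\<^sup>2 = (1 - c) / (1 + c)" unfolding power_divide s2 using n by (simp add: power2_eq_square)
  have p: "1 + ?z\<^sup>2 = 2 / (1 + c)" unfolding z2 using n by (simp add: field_simps)
  show "c = (1 - ?z\<^sup>2) / (1 + ?z\<^sup>2)" unfolding p z2 using n by (simp add: divide_simps)
  show "s = 2 * ?z / (1 + ?z\<^sup>2)" unfolding p using n by (simp add: field_simps)
qed

section \<open>Triangles, corners and edges that a box cannot avoid\<close>

lemma convex_combination_pos:
  fixes z1 z2 z3 :: real
  assumes "0 < z1" "0 < z2" "0 < z3" "0 \<le> l1" "0 \<le> l2" "0 \<le> l3" "l1 + l2 + l3 = 1"
  shows "0 < l1 * z1 + l2 * z2 + l3 * z3"
  using assms by (smt (verit) mult_nonneg_nonneg mult_pos_pos)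

text \<open>Here \<open>u\<close>, \<open>v\<close> are coordinates relative to the centre of the
  box. They differ by at most 1 < 2h between vertices, so the vertices never lie beyond two opposite
  sides. Up to signs this leaves two adjacent sides, say \<open>h \<le> u\<close> and
  \<open>h \<le> v\<close>; then \<open>u + v\<close> is positive at all vertices although its
  weighted mean is 0.\<close>

lemma triangle_core:
  fixes u1 u2 u3 v1 v2 v3 h :: real
  assumes l: "0 \<le> l1" "0 \<le> l2" "0 \<le> l3" "l1 + l2 + l3 = 1"
    and u: "l1 * u1 + l2 * u2 + l3 * u3 = 0" and v: "l1 * v1 + l2 * v2 + l3 * v3 = 0"
    and d: "\<bar>u1 - u2\<bar> \<le> 1" "\<bar>u1 - u3\<bar> \<le> 1" "\<bar>u2 - u3\<bar> \<le> 1" "\<bar>v1 - v2\<bar> \<le> 1" "\<bar>v1 - v3\<bar> \<le> 1" "\<bar>v2 - v3\<bar> \<le> 1"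
    and h: "1 / 2 < h"
    and out: "h \<le> \<bar>u1\<bar> \<or> h \<le> \<bar>v1\<bar>" "h \<le> \<bar>u2\<bar> \<or> h \<le> \<bar>v2\<bar>" "h \<le> \<bar>u3\<bar> \<or> h \<le> \<bar>v3\<bar>"
  shows False
proof -
  have out': "u1 \<le> - h \<or> h \<le> u1 \<or> v1 \<le> - h \<or> h \<le> v1" "u2 \<le> - h \<or> h \<le> u2 \<or> v2 \<le> - h \<or> h \<le> v2"
    "u3 \<le> - h \<or> h \<le> u3 \<or> v3 \<le> - h \<or> h \<le> v3" using out by (auto simp: abs_if split: if_splits)
  note pos = convex_combination_pos[OF _ _ _ l]
  have e: "l1 * (u1 + v1) + l2 * (u2 + v2) + l3 * (u3 + v3) = 0" "l1 * (u1 - v1) + l2 * (u2 - v2) + l3 * (u3 - v3) = 0"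
    "l1 * (v1 - u1) + l2 * (v2 - u2) + l3 * (v3 - u3) = 0" "l1 * (- u1 - v1) + l2 * (- u2 - v2) + l3 * (- u3 - v3) = 0"
    using u v by (simp_all add: algebra_simps)
  have A: "(- h < u1 \<and> - h < u2 \<and> - h < u3) \<or> (u1 < h \<and> u2 < h \<and> u3 < h)" using d h by linarith
  have B: "(- h < v1 \<and> - h < v2 \<and> - h < v3) \<or> (v1 < h \<and> v2 < h \<and> v3 < h)" using d h by linarith
  from A show False
  proof
    assume a: "- h < u1 \<and> - h < u2 \<and> - h < u3"
    from B show False
    proof
      assume b: "- h < v1 \<and> - h < v2 \<and> - h < v3"
      have p1: "0 < u1 + v1" using a b out'(1) by linarith
      have p2: "0 < u2 + v2" using a b out'(2) by linarith
      have p3: "0 < u3 + v3" using a b out'(3) by linarith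
      show False using pos[OF p1 p2 p3] unfolding e(1) by simp
    next
      assume b: "v1 < h \<and> v2 < h \<and> v3 < h"
      have p1: "0 < u1 - v1" using a b out'(1) by linarith
      have p2: "0 < u2 - v2" using a b out'(2) by linarith
      have p3: "0 < u3 - v3" using a b out'(3) by linarith
      show False using pos[OF p1 p2 p3] unfolding e(2) by simp
    qed
  next
    assume a: "u1 < h \<and> u2 < h \<and> u3 < h"
    from B show False
    proof
      assume b: "- h < v1 \<and> - h < v2 \<and> - h < v3"
      have p1: "0 < v1 - u1" using a b out'(1) by linarith
      have p2: "0 < v2 - u2" using a b out'(2) by linarith
      have p3: "0 < v3 - u3" using a b out'(3) by linarith
      show False using pos[OF p1 p2 p3] unfolding e(3) by simp
    next
      assume b: "v1 < h \<and> v2 < h \<and> v3 < h"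
      have p1: "0 < - u1 - v1" using a b out'(1) by linarith
      have p2: "0 < - u2 - v2" using a b out'(2) by linarith
      have p3: "0 < - u3 - v3" using a b out'(3) by linarith
      show False using pos[OF p1 p2 p3] unfolding e(4) by simp
    qed
  qed
qed

lemma rotated_difference:
  fixes a b :: real
  assumes "c * c + s * s = 1" "a * a + b * b \<le> 1"
  shows "\<bar>a * c + b * s\<bar> \<le> 1" "\<bar>b * c - a * s\<bar> \<le> 1"
proof -
  have "(a * c + b * s)\<^sup>2 + (b * c - a * s)\<^sup>2 = (a * a + b * b) * (c * c + s * s)"
    by (simp add: power2_eq_square algebra_simps)
  then have "(a * c + b * s)\<^sup>2 + (b * c - a * s)\<^sup>2 \<le> 1" using assms by simp
  then have "(a * c + b * s)\<^sup>2 \<le> 1\<^sup>2" "(b * c - a * s)\<^sup>2 \<le> 1\<^sup>2"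
    by (smt (verit) one_power2 zero_le_power2)+
  then show "\<bar>a * c + b * s\<bar> \<le> 1" "\<bar>b * c - a * s\<bar> \<le> 1" by (simp_all add: abs_square_le_1)
qed

lemma inb_iff: "inb r c s k m a b \<longleftrightarrow> \<bar>a * c + b * s - (k + r / 2)\<bar> < r / 2 \<and> \<bar>b * c - a * s - (m + r / 2)\<bar> < r / 2"
  unfolding inb_def by (safe; linarith)

lemma centre_e: "c * c + s * s = 1 \<Longrightarrow> cenx r c s k m * c + ceny r c s k m * s = k + r / 2"
proof -
  have "cenx r c s k m * c + ceny r c s k m * s = (k + r / 2) * (c * c + s * s)"
    by (simp add: cenx_def ceny_def field_simps)
  then show "c * c + s * s = 1 \<Longrightarrow> ?thesis" by simp
qed

lemma centre_n: "c * c + s * s = 1 \<Longrightarrow> ceny r c s k m * c - cenx r c s k m * s = m + r / 2"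
proof -
  have "ceny r c s k m * c - cenx r c s k m * s = (m + r / 2) * (c * c + s * s)"
    by (simp add: cenx_def ceny_def field_simps)
  then show "c * c + s * s = 1 \<Longrightarrow> ?thesis" by simp
qed

lemma triangle_hit:
  assumes cs: "c * c + s * s = 1" and r: "1 < r"
    and l: "0 \<le> l1" "0 \<le> l2" "0 \<le> l3" "l1 + l2 + l3 = 1"
    and x: "cenx r c s k m = l1 * a1 + l2 * a2 + l3 * a3" and y: "ceny r c s k m = l1 * b1 + l2 * b2 + l3 * b3"
    and d: "(a1 - a2) * (a1 - a2) + (b1 - b2) * (b1 - b2) \<le> 1" "(a1 - a3) * (a1 - a3) + (b1 - b3) * (b1 - b3) \<le> 1"
      "(a2 - a3) * (a2 - a3) + (b2 - b3) * (b2 - b3) \<le> 1"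
  shows "inb r c s k m a1 b1 \<or> inb r c s k m a2 b2 \<or> inb r c s k m a3 b3"
proof (rule ccontr)
  assume *: "\<not> ?thesis"
  let ?u = "\<lambda>a b. a * c + b * s - (k + r / 2)" and ?v = "\<lambda>a b. b * c - a * s - (m + r / 2)"
  have k: "(l1 + l2 + l3) * (k + r / 2) = k + r / 2" "(l1 + l2 + l3) * (m + r / 2) = m + r / 2" using l by simp_all
  have u: "l1 * ?u a1 b1 + l2 * ?u a2 b2 + l3 * ?u a3 b3 = 0"
    using centre_e[OF cs, of r k m] k(1) unfolding x y by (simp add: field_simps)
  have v: "l1 * ?v a1 b1 + l2 * ?v a2 b2 + l3 * ?v a3 b3 = 0"
    using centre_n[OF cs, of r k m] k(2) unfolding x y by (simp add: field_simps)
  have D: "\<bar>?u a b - ?u a' b'\<bar> \<le> 1" "\<bar>?v a b - ?v a' b'\<bar> \<le> 1"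
    if "(a - a') * (a - a') + (b - b') * (b - b') \<le> 1" for a b a' b'
    using rotated_difference[OF cs that] by (simp_all add: algebra_simps)
  have "1 / 2 < r / 2" using r by simp
  from triangle_core[OF l u v D(1)[OF d(1)] D(1)[OF d(2)] D(1)[OF d(3)] D(2)[OF d(1)] D(2)[OF d(2)] D(2)[OF d(3)] this]
  show False using * unfolding inb_iff by (simp add: not_less)
qed

text \<open>The centre keeps distance \<open>r * (c + s) / 2\<close> from the left and bottom sides,
  so \<open>(a, b)\<close> is off by at most \<open>1 - r * w / 2\<close> in each coordinate. Along
  the frame this gives at most \<open>(1 - r * w / 2) * w\<close>, which is below
  \<open>r / 2\<close> because \<open>2 * w \<le> 1 + w * w\<close>.\<close>

lemma corner_hit:
  assumes f: "fitting r c s k m" and "cenx r c s k m \<le> a" "ceny r c s k m \<le> b" "a \<le> 1" "b \<le> 1"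
  shows "inb r c s k m a b"
proof -
  let ?w = "c + s"
  have f': "1 < r" "0 \<le> c" "0 \<le> s" and cs: "c * c + s * s = 1"
    and g: "0 \<le> k * c - (m + r) * s" "0 \<le> k * s + m * c" using f by (auto simp: fitting_def)
  define p q where "p = a - cenx r c s k m" and "q = b - ceny r c s k m"
  have x: "r * ?w / 2 \<le> cenx r c s k m" "r * ?w / 2 \<le> ceny r c s k m"
    using g by (simp_all add: cenx_def ceny_def field_simps)
  have pq: "0 \<le> p" "0 \<le> q" "p \<le> 1 - r * ?w / 2" "q \<le> 1 - r * ?w / 2" using assms x by (auto simp: p_def q_def)
  have a: "a * c + b * s - (k + r / 2) = p * c + q * s" "b * c - a * s - (m + r / 2) = q * c - p * s"
    using centre_e[OF cs, of r k m] centre_n[OF cs, of r k m] by (simp_all add: p_def q_def algebra_simps)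
  have b: "p * c \<le> (1 - r * ?w / 2) * c" "p * s \<le> (1 - r * ?w / 2) * s" "q * c \<le> (1 - r * ?w / 2) * c" "q * s \<le> (1 - r * ?w / 2) * s"
    using pq f' by (auto intro: mult_right_mono)
  have n: "0 \<le> p * c" "0 \<le> p * s" "0 \<le> q * c" "0 \<le> q * s" using pq f' by simp_all
  have w1: "1 \<le> ?w" using trig_pair[OF f'(2,3) cs] by simp
  have "?w \<le> (1 + ?w * ?w) / 2" using sum_squares_ge_zero[of "?w - 1" 0] by (simp add: algebra_simps)
  also have "\<dots> < r * (1 + ?w * ?w) / 2" using f' mult_strict_right_mono[of 1 r "1 + ?w * ?w"] zero_le_square[of ?w] by linarith
  finally have "(1 - r * ?w / 2) * ?w < r / 2" by (simp add: field_simps)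
  then have "(1 - r * ?w / 2) * c + (1 - r * ?w / 2) * s < r / 2" by (simp add: distrib_left)
  then show ?thesis unfolding inb_iff a using b n by linarith
qed

text \<open>The bottom side keeps the centre at height at least 1/2, so the end points are within
  1/2 of it vertically; this leaves two sides of the box for each end point. Beyond opposite sides
  they cannot be, the segment being too short, and beyond the two lower sides neither, the centre
  being below the segment. So the top vertex sticks out between them.\<close>

lemma edge_exits:
  assumes f: "fitting r c s k m" and l: "0 \<le> l" "l \<le> 1"
    and x: "cenx r c s k m = (1 - l) * x0 + l * x1" and y: "ceny r c s k m \<le> (1 - l) * a + l * b"
    and D: "x0 \<le> x1" "(x1 - x0) * (x1 - x0) + (b - a) * (b - a) \<le> 1"
    and ab: "1 / 2 \<le> a" "a \<le> 1" "1 / 2 \<le> b" "b \<le> 1"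
    and out: "\<not> inb r c s k m x0 a" "\<not> inb r c s k m x1 b"
  shows "m + r \<le> a * c - x0 * s \<and> k + r \<le> x1 * c + b * s"
proof -
  have f': "1 < r" "0 \<le> c" "0 \<le> s" and cs: "c * c + s * s = 1"
    and g: "0 \<le> k * c - (m + r) * s" "0 \<le> k * s + m * c" using f by (auto simp: fitting_def)
  have c1: "c \<le> 1" "s \<le> 1" and w1: "1 \<le> c + s" using trig_pair[OF f'(2,3) cs] by simp_all
  define X Y where "X = cenx r c s k m" and "Y = ceny r c s k m"
  have "r * (c + s) / 2 \<le> Y" using g by (simp add: Y_def ceny_def field_simps)
  moreover have "1 * 1 \<le> r * (c + s)" using f' w1 by (intro mult_mono) auto
  ultimately have Yl: "1 / 2 \<le> Y" by simp
  have "(1 - l) * a + l * b \<le> (1 - l) * 1 + l * 1" using l ab by (intro add_mono mult_left_mono) auto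
  then have Yu: "Y \<le> 1" using y by (simp add: Y_def)
  define d0 d1 where "d0 = a - Y" and "d1 = b - Y"
  have d: "\<bar>d0\<bar> \<le> 1 / 2" "\<bar>d1\<bar> \<le> 1 / 2" unfolding d0_def d1_def using ab Yl Yu by linarith+
  have small: "\<bar>d0 * s\<bar> \<le> 1 / 2" "\<bar>d0 * c\<bar> \<le> 1 / 2" "\<bar>d1 * s\<bar> \<le> 1 / 2" "\<bar>d1 * c\<bar> \<le> 1 / 2"
    using d c1 f' mult_mono[of "\<bar>d0\<bar>" "1/2" s 1] mult_mono[of "\<bar>d0\<bar>" "1/2" c 1]
      mult_mono[of "\<bar>d1\<bar>" "1/2" s 1] mult_mono[of "\<bar>d1\<bar>" "1/2" c 1] by (auto simp: abs_mult)
  have X0: "X - x0 = l * (x1 - x0)" "x1 - X = (1 - l) * (x1 - x0)" using x by (simp_all add: X_def algebra_simps)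
  have nn: "0 \<le> (X - x0) * c" "0 \<le> (X - x0) * s" "0 \<le> (x1 - X) * c" "0 \<le> (x1 - X) * s"
    unfolding X0 using l D f' by simp_all
  define u0 v0 u1 v1 where "u0 = x0 * c + a * s - (k + r / 2)" and "v0 = a * c - x0 * s - (m + r / 2)"
    and "u1 = x1 * c + b * s - (k + r / 2)" and "v1 = b * c - x1 * s - (m + r / 2)"
  note ce = centre_e[OF cs, of r k m, folded X_def Y_def] and cn = centre_n[OF cs, of r k m, folded X_def Y_def]
  have e: "u0 = - ((X - x0) * c) + d0 * s" "v0 = (X - x0) * s + d0 * c" "u1 = (x1 - X) * c + d1 * s" "v1 = - ((x1 - X) * s) + d1 * c"
    unfolding u0_def v0_def u1_def v1_def ce[symmetric] cn[symmetric] d0_def d1_def by (simp_all add: algebra_simps)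
  have dif: "\<bar>u1 - u0\<bar> \<le> 1" "\<bar>v1 - v0\<bar> \<le> 1"
    using rotated_difference[OF cs D(2)] by (simp_all add: u0_def v0_def u1_def v1_def algebra_simps)
  have o: "r / 2 \<le> \<bar>u0\<bar> \<or> r / 2 \<le> \<bar>v0\<bar>" "r / 2 \<le> \<bar>u1\<bar> \<or> r / 2 \<le> \<bar>v1\<bar>"
    using out unfolding inb_iff by (auto simp: u0_def v0_def u1_def v1_def not_less)
  have bd: "u0 < r / 2" "- (r / 2) < v0" "- (r / 2) < u1" "v1 < r / 2"
    using e nn small f' by linarith+
  have s0: "u0 \<le> - (r / 2) \<or> r / 2 \<le> v0" and s1: "r / 2 \<le> u1 \<or> v1 \<le> - (r / 2)" using o bd by linarith+
  \<comment> \<open>\<open>u + v\<close> is affine along the segment and nonnegative at its point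
    above the centre, hence not negative at both ends.\<close>
  have no: "\<not> (u0 \<le> - (r / 2) \<and> v1 \<le> - (r / 2))"
  proof
    assume A: "u0 \<le> - (r / 2) \<and> v1 \<le> - (r / 2)"
    then have "u0 + v0 < 0" "u1 + v1 < 0" using dif f' by linarith+
    then have "(1 - l) * (u0 + v0) + l * (u1 + v1) < 0"
      using convex_combination_pos[of "- (u0 + v0)" "- (u1 + v1)" 1 "1 - l" l 0] l by (simp add: algebra_simps)
    moreover have "(1 - l) * (u0 + v0) + l * (u1 + v1) = ((1 - l) * a + l * b - Y) * (c + s) + ((1 - l) * x0 + l * x1 - X) * (c - s)"
      unfolding e d0_def d1_def by (simp add: algebra_simps)
    moreover have "0 \<le> ((1 - l) * a + l * b - Y) * (c + s)" using y f' by (simp add: Y_def)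
    ultimately show False using x by (simp add: X_def)
  qed
  have "r / 2 \<le> v0" "r / 2 \<le> u1" using s0 s1 no dif f' by linarith+
  then show ?thesis by (simp add: v0_def u1_def)
qed

text \<open>If both upper sides pass below the end points, the top vertex has height at most
  \<open>(x1 - x0) * (c * s) + a * (c * c) + b * (s * s)\<close>. When this is at most
  \<open>c + s\<close>, it is less than the height \<open>r * (c + s)\<close> of the box, whose
  bottom vertex then leaves the square.\<close>

lemma edge_hit:
  assumes f: "fitting r c s k m" and l: "0 \<le> l" "l \<le> 1"
    and x: "cenx r c s k m = (1 - l) * x0 + l * x1" and y: "ceny r c s k m \<le> (1 - l) * a + l * b"
    and D: "x0 \<le> x1" "(x1 - x0) * (x1 - x0) + (b - a) * (b - a) \<le> 1"
    and ab: "1 / 2 \<le> a" "a \<le> 1" "1 / 2 \<le> b" "b \<le> 1"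
    and ineq: "(x1 - x0) * (c * s) + a * (c * c) + b * (s * s) \<le> c + s"
  shows "inb r c s k m x0 a \<or> inb r c s k m x1 b"
proof (rule ccontr)
  assume "\<not> ?thesis"
  then have *: "m + r \<le> a * c - x0 * s" "k + r \<le> x1 * c + b * s" using edge_exits[OF f l x y D ab] by blast+
  have f': "1 < r" "0 \<le> c" "0 \<le> s" and g: "0 \<le> k * s + m * c" using f by (auto simp: fitting_def)
  have "(m + r) * c + (k + r) * s \<le> (a * c - x0 * s) * c + (x1 * c + b * s) * s"
    using mult_right_mono[OF *(1), of c] mult_right_mono[OF *(2), of s] f' by linarith
  also have "\<dots> = (x1 - x0) * (c * s) + a * (c * c) + b * (s * s)" by (simp add: algebra_simps)
  also have "\<dots> \<le> c + s" by fact
  also have "\<dots> < r * (c + s)" using f' mult_strict_right_mono[of 1 r "c + s"] trig_pair(3)[of c s] f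
    by (simp add: fitting_def)
  finally show False using g by (simp add: algebra_simps)
qed

text \<open>With \<open>w = c + s\<close> the claim is \<open>t \<le> w - (w * w - 1) / 2\<close>.
  The right side decreases on [1, sqrt 2], so the worst angle is 45 degrees, and
  \<open>914 / 1000\<close> is sqrt 2 - 1/2 rounded down.\<close>

lemma unit_edge_ineq:
  fixes c s :: real
  assumes "0 \<le> c" "0 \<le> s" "c * c + s * s = 1" "t \<le> (914 / 1000)"
  shows "1 * (c * s) + t * (c * c) + t * (s * s) \<le> c + s"
proof -
  note w = trig_pair[OF assms(1-3)]
  have "0 \<le> (c + s - 1) * ((141422 / 100000) - (c + s))" using w by simp
  moreover have "(c + s - 1) * ((141422 / 100000) - (c + s)) = (241422 / 100000) * (c + s) - (141422 / 100000) - (c * c + s * s) - 2 * (c * s)"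
    by (simp add: field_simps)
  ultimately have "2 * (c * s) \<le> (241422 / 100000) * (c + s) - (241422 / 100000)" unfolding assms(3) by linarith
  moreover have "t * (c * c) + t * (s * s) = t" using assms(3) by (simp flip: distrib_left)
  ultimately have "c * s + t < c + s" using w(4) assms(4) by (simp add: field_simps)
  then show ?thesis using \<open>t * (c * c) + t * (s * s) = t\<close> by linarith
qed

text \<open>This is for the slanted edge next to a side of the square, from abscissa
  \<open>1\<close> to \<open>1 / 2 + u\<close> across a row gap; \<open>b \<le> 9 / 10\<close> is
  what allows \<open>u\<close> up to \<open>4 / 10\<close>. Equality for \<open>c = 1\<close> and
  \<open>b = 9 / 10\<close> shows up as the factor \<open>z\<close> that is split off.\<close>

lemma side_edge_ineq:
  fixes c s :: real
  assumes "0 \<le> c" "0 \<le> s" "c * c + s * s = 1" "b \<le> (9 / 10)"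
  shows "(866 / 1000) * (c * s) + 1 * (c * c) + b * (s * s) \<le> c + s"
proof -
  obtain z where z: "0 \<le> z" "z \<le> 1" and c: "c = (1 - z\<^sup>2) / (1 + z\<^sup>2)" and s: "s = 2 * z / (1 + z\<^sup>2)"
    using half_angle[OF assms(1-3)] by blast
  define N where "N = 1 + z\<^sup>2"
  have N: "0 < N" by (simp add: N_def add_pos_nonneg)
  have cN: "c * N = 1 - z * z" and sN: "s * N = 2 * z" using N unfolding c s N_def[symmetric] by (simp_all add: power2_eq_square)
  \<comment> \<open>On each interval the cube is bounded by a multiple of the square and the square
    by a tangent. The tangent is taken near the minimum of the resulting parabola on the first
    interval and at the left end on the others.\<close>
  have q: "0 < (268 / 1000) - (16 / 10) * z + (3732 / 1000) * (z * z) - 2 * (z * z * z)"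
  proof -
    have sq: "2 * p * z - p * p \<le> z * z" for p using sum_squares_ge_zero[of "z - p" 0] by (simp add: algebra_simps)
    have cube: "z * z * z \<le> p * (z * z)" if "z \<le> p" for p
      using mult_right_mono[OF that, of "z * z"] by (simp add: mult.assoc)
    consider "z \<le> (6 / 10)" | "(6 / 10) \<le> z" "z \<le> (8 / 10)" | "(8 / 10) \<le> z" by linarith
    then show ?thesis
      by cases (use cube[of "(6 / 10)"] sq[of "(316 / 1000)"] cube[of "(8 / 10)"] sq[of "(6 / 10)"] cube[of 1] sq[of "(8 / 10)"] z in linarith)+
  qed
  show ?thesis
  proof (cases "z = 0")
    case True then show ?thesis by (simp add: s c)
  next
    case False
    then have "0 < z * ((268 / 1000) - (16 / 10) * z + (3732 / 1000) * (z * z) - 2 * (z * z * z))" using z q by simp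
    also have "\<dots> = (1 - z * z + 2 * z) * (1 + z * z) - (866 / 1000) * ((1 - z * z) * (2 * z))
        - (1 - z * z) * (1 - z * z) - (9 / 10) * ((2 * z) * (2 * z))"
      by (simp add: field_simps)
    also have "\<dots> = (c * N + s * N) * N - (866 / 1000) * ((c * N) * (s * N)) - (c * N) * (c * N) - (9 / 10) * ((s * N) * (s * N))"
      unfolding cN sN by (simp add: N_def power2_eq_square)
    also have "\<dots> = (c + s - ((866 / 1000) * (c * s) + 1 * (c * c) + (9 / 10) * (s * s))) * (N * N)"
      by (simp add: algebra_simps)
    finally have "0 < c + s - ((866 / 1000) * (c * s) + 1 * (c * c) + (9 / 10) * (s * s))"
      using N by (simp add: zero_less_mult_iff)
    then have "(866 / 1000) * (c * s) + 1 * (c * c) + (9 / 10) * (s * s) < c + s" by simp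
    moreover have "b * (s * s) \<le> (9 / 10) * (s * s)" using assms by (intro mult_right_mono) auto
    ultimately show ?thesis by simp
  qed
qed

section \<open>Unavoidable points\<close>

text \<open>The row gap is slightly smaller than half the square root of 3, so that neighbouring points of consecutive rows
  have distance at most 1. The parameter \<open>t\<close> is the height of the lowest row and \<open>u\<close> moves the end points of the
  rows of five inwards.\<close>

definition Idx :: "(nat \<times> nat) set" where
  "Idx = {(i, j). i < 5 \<and> j < 4 + i mod 2}"

definition pt :: "real \<Rightarrow> real \<Rightarrow> nat \<times> nat \<Rightarrow> real \<times> real" where
  "pt t u = (\<lambda>(i, j). (real j + (if even i then 1 else 1 / 2 + (if j = 0 then u else if j = 4 then - u else 0)),
     t + 866 / 1000 * real i))"

text \<open>After the swap the left side of the square takes the place of the bottom side in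
  \<open>edge_hit\<close>. The two cases are needed because \<open>edge_hit\<close> wants the end
  points in increasing order.\<close>

lemma strip_hit_left:
  assumes f: "fitting r c s k m" and u: "0 \<le> u" "u \<le> 4 / 10" and d: "\<bar>y5 - y4\<bar> = 866 / 1000"
    and l: "0 \<le> l" "l \<le> 1" and y: "ceny r c s k m = (1 - l) * y4 + l * y5"
    and x: "cenx r c s k m \<le> 1 + l * (u - 1 / 2)"
  shows "inb r c s k m 1 y4 \<or> inb r c s k m (1 / 2 + u) y5"
proof -
  note f' = fitting_swap[OF f]
  have cs: "0 \<le> s" "0 \<le> c" "s * s + c * c = 1" "c * c + s * s = 1" using f by (auto simp: fitting_def)
  have u2: "(u - 1 / 2) * (u - 1 / 2) \<le> 1 / 4" using u mult_mono[of "1 / 2 - u" "1 / 2" "1 / 2 - u" "1 / 2"] by (simp add: algebra_simps)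
  show ?thesis
  proof (cases "y4 \<le> y5")
    case True
    then have D: "y5 - y4 = 866 / 1000" using d by simp
    have "inb r s c k (- m - r) y4 1 \<or> inb r s c k (- m - r) y5 (1 / 2 + u)"
    proof (rule edge_hit[OF f' l])
      show "cenx r s c k (- m - r) = (1 - l) * y4 + l * y5" by (simp add: cenx_swap y)
      show "ceny r s c k (- m - r) \<le> (1 - l) * 1 + l * (1 / 2 + u)" using x by (simp add: ceny_swap algebra_simps)
      show "(y5 - y4) * (y5 - y4) + (1 / 2 + u - 1) * (1 / 2 + u - 1) \<le> 1"
        unfolding D using u2 by simp
      show "(y5 - y4) * (s * c) + 1 * (s * s) + (1 / 2 + u) * (c * c) \<le> s + c"
        unfolding D using side_edge_ineq[OF cs(1-3), of "1 / 2 + u"] u by simp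
    qed (use True u in auto)
    then show ?thesis by (simp add: inb_swap)
  next
    case False
    then have D: "y4 - y5 = 866 / 1000" using d by simp
    have "inb r s c k (- m - r) y5 (1 / 2 + u) \<or> inb r s c k (- m - r) y4 1"
    proof (rule edge_hit[OF f', of "1 - l"])
      show "cenx r s c k (- m - r) = (1 - (1 - l)) * y5 + (1 - l) * y4" by (simp add: cenx_swap y)
      show "ceny r s c k (- m - r) \<le> (1 - (1 - l)) * (1 / 2 + u) + (1 - l) * 1" using x by (simp add: ceny_swap algebra_simps)
      show "(y4 - y5) * (y4 - y5) + (1 - (1 / 2 + u)) * (1 - (1 / 2 + u)) \<le> 1"
        unfolding D using u2 by (simp add: algebra_simps)
      show "(y4 - y5) * (s * c) + (1 / 2 + u) * (s * s) + 1 * (c * c) \<le> s + c"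
        unfolding D using side_edge_ineq[OF cs(2,1,4), of "1 / 2 + u"] u by (simp add: algebra_simps)
    qed (use False u l in auto)
    then show ?thesis by (auto simp: inb_swap)
  qed
qed

lemma strip_hit_right:
  assumes f: "fitting r c s k m" and u: "0 \<le> u" "u \<le> 4 / 10" and d: "\<bar>y5 - y4\<bar> = 866 / 1000"
    and l: "0 \<le> l" "l \<le> 1" and y: "ceny r c s k m = (1 - l) * y4 + l * y5"
    and x: "4 - l * (u - 1 / 2) \<le> cenx r c s k m"
  shows "inb r c s k m 4 y4 \<or> inb r c s k m (9 / 2 - u) y5"
proof -
  have cs: "c * c + s * s = 1" using f by (simp add: fitting_def)
  have "inb r s c (5 * s + m) (k - 5 * c) 1 y4 \<or> inb r s c (5 * s + m) (k - 5 * c) (1 / 2 + u) y5"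
    by (rule strip_hit_left[OF fitting_reflx[OF f] u d l]) (use x y in \<open>simp_all add: cenx_reflx[OF cs] ceny_reflx\<close>)
  then show ?thesis using inb_reflx[of r s c m k 4 y4] inb_reflx[of r s c m k "9 / 2 - u" y5] by simp
qed

text \<open>Barycentric coordinates in a triangle with two vertices in the row of four: the height
  fixes the weight \<open>l\<close> of the apex. Its slanted sides are short enough since
  \<open>(866 / 1000)^2 + 1 / 4 \<le> 1\<close>.\<close>

lemma strip_triangle_4:
  assumes f: "fitting r c s k m" and d: "\<bar>y5 - y4\<bar> = 866 / 1000"
    and l: "0 \<le> l" "l \<le> 1" and y: "ceny r c s k m = (1 - l) * y4 + l * y5"
    and x: "x4 + l / 2 \<le> cenx r c s k m" "cenx r c s k m \<le> x4 + 1 - l / 2"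
  shows "inb r c s k m x4 y4 \<or> inb r c s k m (x4 + 1) y4 \<or> inb r c s k m (x4 + 1 / 2) y5"
proof (rule triangle_hit[where ?l1.0 = "x4 + 1 - l / 2 - cenx r c s k m" and ?l2.0 = "cenx r c s k m - x4 - l / 2" and ?l3.0 = l])
  have D: "(y5 - y4) * (y5 - y4) = (866 / 1000) * (866 / 1000)" "(y4 - y5) * (y4 - y5) = (866 / 1000) * (866 / 1000)"
    using d by (metis abs_mult_self_eq, metis abs_minus_commute abs_mult_self_eq)
  show "cenx r c s k m = (x4 + 1 - l / 2 - cenx r c s k m) * x4 + (cenx r c s k m - x4 - l / 2) * (x4 + 1) + l * (x4 + 1 / 2)"
    by (simp add: field_simps)
  show "ceny r c s k m = (x4 + 1 - l / 2 - cenx r c s k m) * y4 + (cenx r c s k m - x4 - l / 2) * y4 + l * y5"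
    unfolding y by (simp add: field_simps)
  show "(x4 - (x4 + 1 / 2)) * (x4 - (x4 + 1 / 2)) + (y4 - y5) * (y4 - y5) \<le> 1"
    "(x4 + 1 - (x4 + 1 / 2)) * (x4 + 1 - (x4 + 1 / 2)) + (y4 - y5) * (y4 - y5) \<le> 1" unfolding D by simp_all
qed (use f x l in \<open>auto simp: fitting_def\<close>)

lemma strip_triangle_5:
  assumes f: "fitting r c s k m" and d: "\<bar>y5 - y4\<bar> = 866 / 1000"
    and l: "0 \<le> l" "l \<le> 1" and y: "ceny r c s k m = (1 - l) * y4 + l * y5"
    and x: "(1 - l) * x4 + l * p \<le> cenx r c s k m" "cenx r c s k m \<le> (1 - l) * x4 + l * q"
    and pq: "x4 - 1 / 2 \<le> p" "p \<le> x4" "x4 \<le> q" "q \<le> x4 + 1 / 2" "p < q"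
  shows "inb r c s k m x4 y4 \<or> inb r c s k m p y5 \<or> inb r c s k m q y5"
proof -
  \<comment> \<open>The weight of \<open>q\<close>: the height gives weight \<open>1 - l\<close> to
    \<open>x4\<close>, and the abscissa determines how the rest is shared between \<open>p\<close>
    and \<open>q\<close>.\<close>
  define v where "v = (cenx r c s k m - (1 - l) * x4 - l * p) / (q - p)"
  have v: "v * (q - p) = cenx r c s k m - (1 - l) * x4 - l * p" using pq by (simp add: v_def)
  have "v * (q - p) \<le> l * (q - p)" unfolding v using x by (simp add: algebra_simps)
  then have vl: "v \<le> l" using pq by simp
  have v0: "0 \<le> v" using x pq by (simp add: v_def)
  have D: "(y4 - y5) * (y4 - y5) = (866 / 1000) * (866 / 1000)"
    using d by (metis abs_minus_commute abs_mult_self_eq)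
  have sq: "e * e \<le> 1 / 4" if "\<bar>e\<bar> \<le> 1 / 2" for e :: real
    using mult_mono[OF that that] by (simp flip: abs_mult)
  show ?thesis
  proof (rule triangle_hit[where ?l1.0 = "1 - l" and ?l2.0 = "l - v" and ?l3.0 = v])
    show "cenx r c s k m = (1 - l) * x4 + (l - v) * p + v * q" using v by (simp add: algebra_simps)
    show "ceny r c s k m = (1 - l) * y4 + (l - v) * y5 + v * y5" unfolding y by (simp add: algebra_simps)
    show "(x4 - p) * (x4 - p) + (y4 - y5) * (y4 - y5) \<le> 1" "(x4 - q) * (x4 - q) + (y4 - y5) * (y4 - y5) \<le> 1"
      unfolding D using sq[of "x4 - p"] sq[of "x4 - q"] pq by auto
    show "(p - q) * (p - q) + (y5 - y5) * (y5 - y5) \<le> 1"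
      using pq mult_mono[of "q - p" 1 "q - p" 1] by (simp add: algebra_simps)
  qed (use f l v0 vl in \<open>auto simp: fitting_def\<close>)
qed

lemma strip_hit:
  assumes f: "fitting r c s k m" and u: "0 \<le> u" "u \<le> 4 / 10" and d: "\<bar>y5 - y4\<bar> = 866 / 1000"
    and l: "0 \<le> l" "l \<le> 1" and y: "ceny r c s k m = (1 - l) * y4 + l * y5"
  shows "inb r c s k m 1 y4 \<or> inb r c s k m 2 y4 \<or> inb r c s k m 3 y4 \<or> inb r c s k m 4 y4 \<or>
    inb r c s k m (1 / 2 + u) y5 \<or> inb r c s k m (3 / 2) y5 \<or> inb r c s k m (5 / 2) y5 \<or> inb r c s k m (7 / 2) y5 \<or>
    inb r c s k m (9 / 2 - u) y5"
proof -
  let ?x = "cenx r c s k m"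
  note up = strip_triangle_4[OF f d l y] and down = strip_triangle_5[OF f d l y]
  \<comment> \<open>Cut of the strip along the slanted edges: at the level \<open>l\<close>
    triangles of the two kinds alternate, and the first and last case lie beyond the outermost
    edges.\<close>
  consider "?x \<le> 1 - l / 2 + l * u" | "1 - l / 2 + l * u \<le> ?x" "?x \<le> 1 + l / 2"
    | "1 + l / 2 \<le> ?x" "?x \<le> 2 - l / 2" | "2 - l / 2 \<le> ?x" "?x \<le> 2 + l / 2"
    | "2 + l / 2 \<le> ?x" "?x \<le> 3 - l / 2" | "3 - l / 2 \<le> ?x" "?x \<le> 3 + l / 2"
    | "3 + l / 2 \<le> ?x" "?x \<le> 4 - l / 2" | "4 - l / 2 \<le> ?x" "?x \<le> 4 + l / 2 - l * u"
    | "4 + l / 2 - l * u \<le> ?x"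
    by linarith
  then show ?thesis
  proof cases
    case 1
    have "inb r c s k m 1 y4 \<or> inb r c s k m (1 / 2 + u) y5"
      by (rule strip_hit_left[OF f u d l y]) (use 1 in \<open>simp add: algebra_simps\<close>)
    then show ?thesis by blast
  next
    case 2
    have "inb r c s k m 1 y4 \<or> inb r c s k m (1 / 2 + u) y5 \<or> inb r c s k m (3 / 2) y5"
      by (rule down) (use 2 u in \<open>simp_all add: algebra_simps\<close>)
    then show ?thesis by blast
  next
    case 3
    have "inb r c s k m 1 y4 \<or> inb r c s k m (1 + 1) y4 \<or> inb r c s k m (1 + 1 / 2) y5"
      by (rule up) (use 3 in simp_all)
    then show ?thesis by auto
  next
    case 4
    have "inb r c s k m 2 y4 \<or> inb r c s k m (3 / 2) y5 \<or> inb r c s k m (5 / 2) y5"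
      by (rule down) (use 4 u in \<open>simp_all add: algebra_simps\<close>)
    then show ?thesis by blast
  next
    case 5
    have "inb r c s k m 2 y4 \<or> inb r c s k m (2 + 1) y4 \<or> inb r c s k m (2 + 1 / 2) y5"
      by (rule up) (use 5 in simp_all)
    then show ?thesis by auto
  next
    case 6
    have "inb r c s k m 3 y4 \<or> inb r c s k m (5 / 2) y5 \<or> inb r c s k m (7 / 2) y5"
      by (rule down) (use 6 u in \<open>simp_all add: algebra_simps\<close>)
    then show ?thesis by blast
  next
    case 7
    have "inb r c s k m 3 y4 \<or> inb r c s k m (3 + 1) y4 \<or> inb r c s k m (3 + 1 / 2) y5"
      by (rule up) (use 7 in simp_all)
    then show ?thesis by auto
  next
    case 8
    have "inb r c s k m 4 y4 \<or> inb r c s k m (7 / 2) y5 \<or> inb r c s k m (9 / 2 - u) y5"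
      by (rule down) (use 8 u in \<open>simp_all add: algebra_simps\<close>)
    then show ?thesis by blast
  next
    case 9
    have "inb r c s k m 4 y4 \<or> inb r c s k m (9 / 2 - u) y5"
      by (rule strip_hit_right[OF f u d l y]) (use 9 in \<open>simp add: algebra_simps\<close>)
    then show ?thesis by blast
  qed
qed

lemma bottom_hit:
  assumes f: "fitting r c s k m" and t: "1 / 2 \<le> t" "t \<le> 914 / 1000" and y: "ceny r c s k m \<le> t"
  shows "inb r c s k m 1 t \<or> inb r c s k m 2 t \<or> inb r c s k m 3 t \<or> inb r c s k m 4 t"
proof -
  let ?x = "cenx r c s k m"
  have cs: "0 \<le> c" "0 \<le> s" "c * c + s * s = 1" using f by (auto simp: fitting_def)
  have edge: "inb r c s k m x0 t \<or> inb r c s k m (x0 + 1) t" if "x0 \<le> ?x" "?x \<le> x0 + 1" for x0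
    by (rule edge_hit[OF f, of "?x - x0"])
      (use that t y unit_edge_ineq[OF cs t(2)] in \<open>simp_all add: algebra_simps\<close>)
  have right: "inb r c s k m 4 t" if "4 \<le> ?x"
  proof -
    have "inb r s c (5 * s + m) (k - 5 * c) 1 t"
      by (rule corner_hit[OF fitting_reflx[OF f]]) (use that t y in \<open>simp_all add: cenx_reflx[OF cs(3)] ceny_reflx\<close>)
    then show ?thesis using inb_reflx[of r s c m k 4 t] by simp
  qed
  consider "?x \<le> 1" | "1 \<le> ?x" "?x \<le> 1 + 1" | "2 \<le> ?x" "?x \<le> 2 + 1" | "3 \<le> ?x" "?x \<le> 3 + 1" | "4 \<le> ?x"
    by linarith
  then show ?thesis
  proof cases
    case 1 then show ?thesis using corner_hit[OF f 1 y] t by simp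
  next
    case 2 from edge[OF this] show ?thesis by auto
  next
    case 3 from edge[OF this] show ?thesis by auto
  next
    case 4 from edge[OF this] show ?thesis by auto
  next
    case 5 from right[OF this] show ?thesis by simp
  qed
qed

section \<open>Hitting the whole arrangement\<close>

definition hits :: "real \<Rightarrow> real \<Rightarrow> real \<Rightarrow> real \<Rightarrow> real \<Rightarrow> real \<Rightarrow> real \<Rightarrow> bool" where
  "hits r c s k m t u \<longleftrightarrow> (\<exists>i\<in>Idx. inb r c s k m (fst (pt t u i)) (snd (pt t u i)))"

lemma hits_intro:
  assumes "i < 5" "j < 4 + i mod 2" "inb r c s k m a b" "pt t u (i, j) = (a, b)"
  shows "hits r c s k m t u"
  using assms unfolding hits_def Idx_def by force

lemma hits_row4:
  assumes "i < 5" "even i" "b = t + 866 / 1000 * real i"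
    and "inb r c s k m 1 b \<or> inb r c s k m 2 b \<or> inb r c s k m 3 b \<or> inb r c s k m 4 b"
  shows "hits r c s k m t u"
  using assms(4)
proof (elim disjE)
  assume "inb r c s k m 1 b"
  then show ?thesis by (rule hits_intro[of i 0, rotated 2]) (use assms(1-3) in \<open>simp_all add: pt_def\<close>)
next
  assume "inb r c s k m 2 b"
  then show ?thesis by (rule hits_intro[of i 1, rotated 2]) (use assms(1-3) in \<open>simp_all add: pt_def\<close>)
next
  assume "inb r c s k m 3 b"
  then show ?thesis by (rule hits_intro[of i 2, rotated 2]) (use assms(1-3) in \<open>simp_all add: pt_def\<close>)
next
  assume "inb r c s k m 4 b"
  then show ?thesis by (rule hits_intro[of i 3, rotated 2]) (use assms(1-3) in \<open>simp_all add: pt_def\<close>)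
qed

lemma hits_row5:
  assumes "i < 5" "odd i" "b = t + 866 / 1000 * real i"
    and "inb r c s k m (1 / 2 + u) b \<or> inb r c s k m (3 / 2) b \<or> inb r c s k m (5 / 2) b \<or> inb r c s k m (7 / 2) b \<or> inb r c s k m (9 / 2 - u) b"
  shows "hits r c s k m t u"
proof -
  have odd_mod: "i mod 2 = Suc 0" using assms(2) by presburger
  show ?thesis
    using assms(4)
  proof (elim disjE)
    assume "inb r c s k m (1 / 2 + u) b"
    then show ?thesis by (rule hits_intro[of i 0, rotated 2]) (use assms(1-3) odd_mod in \<open>simp_all add: pt_def\<close>)
  next
    assume "inb r c s k m (3 / 2) b"
    then show ?thesis by (rule hits_intro[of i 1, rotated 2]) (use assms(1-3) odd_mod in \<open>simp_all add: pt_def\<close>)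
  next
    assume "inb r c s k m (5 / 2) b"
    then show ?thesis by (rule hits_intro[of i 2, rotated 2]) (use assms(1-3) odd_mod in \<open>simp_all add: pt_def\<close>)
  next
    assume "inb r c s k m (7 / 2) b"
    then show ?thesis by (rule hits_intro[of i 3, rotated 2]) (use assms(1-3) odd_mod in \<open>simp_all add: pt_def\<close>)
  next
    assume "inb r c s k m (9 / 2 - u) b"
    then show ?thesis by (rule hits_intro[of i 4, rotated 2]) (use assms(1-3) odd_mod in \<open>simp_all add: pt_def\<close>)
  qed
qed

lemma strip_row_hit:
  assumes f: "fitting r c s k m" and u: "0 \<le> u" "u \<le> 4 / 10" and i: "i < 4"
    and y: "t + 866 / 1000 * real i \<le> ceny r c s k m" "ceny r c s k m \<le> t + 866 / 1000 * real (Suc i)"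
  shows "hits r c s k m t u"
proof -
  define l where "l = (ceny r c s k m - (t + 866 / 1000 * real i)) / (866 / 1000)"
  have l: "0 \<le> l" "l \<le> 1" using y by (simp_all add: l_def field_simps)
  have yl: "ceny r c s k m = t + 866 / 1000 * real i + 866 / 1000 * l" by (simp add: l_def field_simps)
  show ?thesis
  proof (cases "even i")
    case True
    define y4 y5 where y45: "y4 = t + 866 / 1000 * real i" "y5 = t + 866 / 1000 * real (Suc i)"
    have d: "\<bar>y5 - y4\<bar> = 866 / 1000" by (simp add: y45 field_simps)
    have y: "ceny r c s k m = (1 - l) * y4 + l * y5" unfolding yl y45 by (simp add: field_simps)
    have "hits r c s k m t u" if "inb r c s k m 1 y4 \<or> inb r c s k m 2 y4 \<or> inb r c s k m 3 y4 \<or> inb r c s k m 4 y4"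
      by (rule hits_row4[OF _ True y45(1) that]) (use i in simp)
    moreover have "hits r c s k m t u" if "inb r c s k m (1 / 2 + u) y5 \<or> inb r c s k m (3 / 2) y5 \<or>
        inb r c s k m (5 / 2) y5 \<or> inb r c s k m (7 / 2) y5 \<or> inb r c s k m (9 / 2 - u) y5"
      by (rule hits_row5[OF _ _ y45(2) that]) (use i True in simp_all)
    ultimately show ?thesis using strip_hit[OF f u d l y] by blast
  next
    case False
    define y4 y5 where y45: "y4 = t + 866 / 1000 * real (Suc i)" "y5 = t + 866 / 1000 * real i"
    have d: "\<bar>y5 - y4\<bar> = 866 / 1000" by (simp add: y45 field_simps)
    have y: "ceny r c s k m = (1 - (1 - l)) * y4 + (1 - l) * y5" unfolding yl y45 by (simp add: field_simps)
    have l': "0 \<le> 1 - l" "1 - l \<le> 1" using l by simp_all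
    have "hits r c s k m t u" if "inb r c s k m 1 y4 \<or> inb r c s k m 2 y4 \<or> inb r c s k m 3 y4 \<or> inb r c s k m 4 y4"
      by (rule hits_row4[OF _ _ y45(1) that]) (use i False in simp_all)
    moreover have "hits r c s k m t u" if "inb r c s k m (1 / 2 + u) y5 \<or> inb r c s k m (3 / 2) y5 \<or>
        inb r c s k m (5 / 2) y5 \<or> inb r c s k m (7 / 2) y5 \<or> inb r c s k m (9 / 2 - u) y5"
      by (rule hits_row5[OF _ False y45(2) that]) (use i in simp)
    ultimately show ?thesis using strip_hit[OF f u d l' y] by blast
  qed
qed

lemma strips_hit:
  assumes f: "fitting r c s k m" and u: "0 \<le> u" "u \<le> 4 / 10"
    and y: "t \<le> ceny r c s k m" "ceny r c s k m \<le> t + 3464 / 1000"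
  shows "hits r c s k m t u"
proof -
  note h = strip_row_hit[OF f u]
  consider "ceny r c s k m \<le> t + 866 / 1000" | "t + 866 / 1000 \<le> ceny r c s k m" "ceny r c s k m \<le> t + 1732 / 1000"
    | "t + 1732 / 1000 \<le> ceny r c s k m" "ceny r c s k m \<le> t + 2598 / 1000" | "t + 2598 / 1000 \<le> ceny r c s k m"
    by linarith
  then show ?thesis
  proof cases
    case 1 then show ?thesis using h[of 0 t] y by simp
  next
    case 2 then show ?thesis using h[of 1 t] by simp
  next
    case 3 then show ?thesis using h[of 2 t] by simp
  next
    case 4 then show ?thesis using h[of 3 t] y by simp
  qed
qed

section \<open>Reflection in the horizontal midline\<close>

definition flip :: "nat \<times> nat \<Rightarrow> nat \<times> nat" where "flip = (\<lambda>(i, j). (4 - i, j))"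

lemma flip_Idx:
  assumes "i \<in> Idx"
  shows "flip i \<in> Idx"
proof -
  obtain a j where i: "i = (a, j)" "a < 5" "j < 4 + a mod 2" using assms by (auto simp: Idx_def)
  then have "a = 0 \<or> a = 1 \<or> a = 2 \<or> a = 3 \<or> a = 4" by linarith
  then show ?thesis using i by (elim disjE) (simp_all add: Idx_def flip_def)
qed

text \<open>\<open>1536 / 1000\<close> is \<open>5 - 4 * (866 / 1000)\<close>, the sum of the
  margins below the lowest and above the highest row; the reflection exchanges the two
  margins.\<close>

lemma pt_flip:
  assumes "i \<in> Idx"
  shows "pt t u (flip i) = (fst (pt (1536 / 1000 - t) u i), 5 - snd (pt (1536 / 1000 - t) u i))"
proof -
  obtain a j where i: "i = (a, j)" "a < 5" using assms by (auto simp: Idx_def)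
  then have "a = 0 \<or> a = 1 \<or> a = 2 \<or> a = 3 \<or> a = 4" by linarith
  then show ?thesis unfolding i(1) flip_def pt_def by (elim disjE) simp_all
qed

lemma inb_refly: "inb r s c (5 * c - m - r) (5 * s - k - r) a (5 - b) \<longleftrightarrow> inb r c s k m a b"
  by (auto simp: inb_def algebra_simps)

lemma fitting_refly: "fitting r c s k m \<Longrightarrow> fitting r s c (5 * c - m - r) (5 * s - k - r)"
proof -
  have e: "- (k - 5 * s) - r = 5 * s - k - r" "5 * c + (- m - r) = 5 * c - m - r" by simp_all
  show "fitting r c s k m \<Longrightarrow> ?thesis" using fitting_swap[OF fitting_reflx[OF fitting_swap], of r c s k m] unfolding e .
qed

lemma ceny_refly:
  assumes "c * c + s * s = 1"
  shows "ceny r s c (5 * c - m - r) (5 * s - k - r) = 5 - ceny r c s k m"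
proof -
  have "ceny r s c (5 * c - m - r) (5 * s - k - r) = 5 * (c * c + s * s) - ceny r c s k m"
    by (simp add: ceny_def field_simps)
  then show ?thesis using assms by simp
qed

lemma hits_refly:
  assumes "hits r s c (5 * c - m - r) (5 * s - k - r) (1536 / 1000 - t) u"
  shows "hits r c s k m t u"
proof -
  obtain i where i: "i \<in> Idx"
    "inb r s c (5 * c - m - r) (5 * s - k - r) (fst (pt (1536 / 1000 - t) u i)) (snd (pt (1536 / 1000 - t) u i))"
    using assms by (auto simp: hits_def)
  have "inb r c s k m (fst (pt t u (flip i))) (snd (pt t u (flip i)))"
    using i(2) inb_refly[of r s c m k _ "5 - snd (pt (1536 / 1000 - t) u i)"] by (simp add: pt_flip[OF i(1)])
  then show ?thesis using flip_Idx[OF i(1)] by (auto simp: hits_def)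
qed

lemma hits_bottom:
  assumes "fitting r c s k m" "1 / 2 \<le> t" "t \<le> 914 / 1000" "ceny r c s k m \<le> t"
  shows "hits r c s k m t u"
  using bottom_hit[OF assms] hits_row4[of 0 t t] by simp

lemma hits_top:
  assumes f: "fitting r c s k m" and t: "622 / 1000 \<le> t" "t \<le> 1036 / 1000" and y: "t + 3464 / 1000 \<le> ceny r c s k m"
  shows "hits r c s k m t u"
proof (rule hits_refly)
  have cs: "c * c + s * s = 1" using f by (simp add: fitting_def)
  show "hits r s c (5 * c - m - r) (5 * s - k - r) (1536 / 1000 - t) u"
    by (rule hits_bottom[OF fitting_refly[OF f]]) (use t y in \<open>simp_all add: ceny_refly[OF cs]\<close>)
qed

text \<open>\<open>622 / 1000\<close> and \<open>1036 / 1000\<close> keep the margin above the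
  highest row between 1/2 and \<open>914 / 1000\<close>. The last hypothesis isolates the one
  situation not covered: a lowest row above \<open>914 / 1000\<close> with the centre below
  it.\<close>

lemma hits_lattice:
  assumes f: "fitting r c s k m" and u: "0 \<le> u" "u \<le> 4 / 10" and t: "622 / 1000 \<le> t" "t \<le> 1036 / 1000"
    and y: "t \<le> 914 / 1000 \<or> t \<le> ceny r c s k m"
  shows "hits r c s k m t u"
proof -
  consider "ceny r c s k m < t" | "t \<le> ceny r c s k m" "ceny r c s k m \<le> t + 3464 / 1000" | "t + 3464 / 1000 \<le> ceny r c s k m"
    by linarith
  then show ?thesis
  proof cases
    case 1 then show ?thesis using hits_bottom[OF f] t y by auto
  next
    case 2 then show ?thesis using strips_hit[OF f u] by auto
  next
    case 3 then show ?thesis using hits_top[OF f t] by auto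
  qed
qed

section \<open>Tracking\<close>

text \<open>While the point at abscissa \<open>x0 + 1\<close> slides from \<open>t0\<close> to
  \<open>t1\<close>, it stays outside, below the lower right side or beyond the upper right one. At
  \<open>t0\<close> the latter is excluded by \<open>ineq1\<close>. If the former still holds at
  \<open>t1\<close>, the box is almost upright and \<open>ineq2\<close> applies. Otherwise the right
  vertex does not pass the vertical line at \<open>x0 + 1\<close>, which leads to
  \<open>r + r * (c * s) \<le> c + s\<close>, against
  \<open>0 \<le> (1 - c) * (1 - s)\<close>.\<close>

lemma extension_core:
  assumes r: "1 < r" and cs: "0 \<le> c" "0 \<le> s" "c * c + s * s = 1" and bottom: "0 \<le> k * s + m * c"
    and N: "m + r \<le> t * c - x0 * s" and E: "k + r \<le> (x0 + 1) * c + t * s"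
    and t: "t0 \<le> t1" "t \<le> 1"
    and inside: "\<And>y. t0 \<le> y \<Longrightarrow> y \<le> t1 \<Longrightarrow> inb r c s k m x0 y"
    and outside: "\<And>y. t0 \<le> y \<Longrightarrow> y \<le> t1 \<Longrightarrow> \<not> inb r c s k m (x0 + 1) y"
    and ineq1: "c * s + t0 * (s * s) + t * (c * c) \<le> c + s"
    and ineq2: "1 \<le> s + (t - t1) * c \<Longrightarrow> t + c * s \<le> c + s"
  shows False
proof -
  have w: "1 \<le> c + s" "c \<le> 1" "s \<le> 1" using trig_pair[OF cs] by simp_all
  have rw: "c + s < r * (c + s)" using r w mult_strict_right_mono[of 1 r "c + s"] by simp
  \<comment> \<open>The argument of \<open>edge_hit\<close>, with the right end point at a height
    \<open>y\<close> that may differ from \<open>t\<close>.\<close>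
  have top: False if "k + r \<le> (x0 + 1) * c + y * s" "c * s + y * (s * s) + t * (c * c) \<le> c + s" for y
  proof -
    have "(k + r) * s + (m + r) * c \<le> ((x0 + 1) * c + y * s) * s + (t * c - x0 * s) * c"
      using mult_right_mono[OF that(1) cs(2)] mult_right_mono[OF N cs(1)] by linarith
    also have "\<dots> = c * s + y * (s * s) + t * (c * c)" by (simp add: algebra_simps)
    finally have "(k + r) * s + (m + r) * c \<le> c + s" using that(2) by linarith
    moreover have "(k + r) * s + (m + r) * c = (k * s + m * c) + r * (c + s)" by (simp add: algebra_simps)
    ultimately show False using bottom rw by linarith
  qed
  have exit: "k + r \<le> (x0 + 1) * c + y * s \<or> y * c - (x0 + 1) * s \<le> m" if "t0 \<le> y" "y \<le> t1" for y
    using inside[OF that] outside[OF that] cs(1,2) unfolding inb_def by (auto simp: distrib_right not_less)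
  have e0: "t0 * c - (x0 + 1) * s \<le> m" using exit[of t0] top[of t0] ineq1 t by auto
  have i0: "m < t0 * c - x0 * s" using inside[of t0] t by (simp add: inb_def)
  have "s \<noteq> 0" using e0 i0 by auto
  moreover have "c \<noteq> 0"
  proof
    assume "c = 0"
    moreover from this have "s = 1" using cs by (simp add: square_eq_1_iff)
    ultimately show False using N e0 r by simp
  qed
  ultimately have pos: "0 < s" "0 < c" using cs by simp_all
  from exit[of t1] t consider "t1 * c - (x0 + 1) * s \<le> m" | "k + r \<le> (x0 + 1) * c + t1 * s" by auto
  then show False
  proof cases
    case 1
    then have "1 \<le> s + (t - t1) * c" using N r by (simp add: algebra_simps)
    from ineq2[OF this] have "c * s + t * (s * s) + t * (c * c) \<le> c + s"
      using cs(3) by (simp add: add.assoc flip: distrib_left) (simp add: add.commute)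
    with top[OF E] show False .
  next
    case 2
    \<comment> \<open>Otherwise the vertical line crosses the lower right side at a smaller height
      than the upper right side. These heights are the two fractions below and lie in
      \<open>[t0, t1]\<close>, so a \<open>y\<close> between them contradicts
      \<open>exit\<close>.\<close>
    have R: "(k + r) * c - m * s \<le> x0 + 1"
    proof (rule ccontr)
      assume "\<not> ?thesis"
      then have "(x0 + 1) * (c * c + s * s) < (k + r) * c - m * s" using cs(3) by simp
      then have "(m + (x0 + 1) * s) * s < (k + r - (x0 + 1) * c) * c" by (simp add: algebra_simps)
      then have lt: "(m + (x0 + 1) * s) / c < (k + r - (x0 + 1) * c) / s" using pos by (simp add: field_simps)
      obtain y where y: "(m + (x0 + 1) * s) / c < y" "y < (k + r - (x0 + 1) * c) / s" using dense[OF lt] by blast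
      have "t0 \<le> (m + (x0 + 1) * s) / c" "(k + r - (x0 + 1) * c) / s \<le> t1"
        using e0 2 pos by (simp_all add: field_simps)
      with y have "t0 \<le> y" "y \<le> t1" by linarith+
      from exit[OF this] y pos show False by (auto simp: field_simps)
    qed
    have "((k + r) * c - m * s) * s \<le> (x0 + 1) * s" using R cs by (intro mult_right_mono)
    moreover have "((k + r) * c - m * s) * s = (k * s + m * c) * c - m * (c * c + s * s) + r * (c * s)"
      by (simp add: algebra_simps)
    moreover have "0 \<le> (k * s + m * c) * c" using bottom cs by simp
    ultimately have "r * (c * s) - m \<le> (x0 + 1) * s" using cs(3) by simp
    then have "r + r * (c * s) \<le> t * c + s" using N by (simp add: algebra_simps)
    moreover have "t * c \<le> c" using t(2) cs(1) mult_right_mono[of t 1 c] by simp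
    moreover have "0 \<le> (1 - c) * (1 - s)" using w by simp
    moreover have "1 * (c * s) \<le> r * (c * s)" using r cs by (intro mult_right_mono) auto
    ultimately show False using r by (simp add: algebra_simps)
  qed
qed

text \<open>In the half-angle tangent \<open>z\<close> the claim reduces to
  \<open>0 \<le> 2 * z^3 - 3 * p * z^2 + p^3\<close>, which is
  \<open>(z - p)^2 * (2 * z + p)\<close>. So \<open>p\<close> is a double root, and its hypotheses
  compare coefficients.\<close>

lemma extension_ineq1:
  fixes c s :: real
  assumes cs: "0 \<le> c" "0 \<le> s" "c * c + s * s = 1" and p: "0 \<le> p" "4 * t0 - 2 * t \<le> 3 * p" "p * p * p \<le> 1 - t"
    and t': "t' \<le> t" "t \<le> 1"
  shows "c * s + t0 * (s * s) + t' * (c * c) \<le> c + s"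
proof -
  obtain z where z: "0 \<le> z" "z \<le> 1" and c: "c = (1 - z\<^sup>2) / (1 + z\<^sup>2)" and s: "s = 2 * z / (1 + z\<^sup>2)"
    using half_angle[OF cs] by blast
  define N where "N = 1 + z\<^sup>2"
  have N: "0 < N" by (simp add: N_def add_pos_nonneg)
  have cN: "c * N = 1 - z * z" and sN: "s * N = 2 * z" using N unfolding c s N_def[symmetric] by (simp_all add: power2_eq_square)
  have "0 \<le> (z - p) * (z - p) * (2 * z + p)" using z p by simp
  moreover have "(4 * t0 - 2 * t) * (z * z) \<le> 3 * p * (z * z)" using p by (intro mult_right_mono) auto
  moreover have "z * (z * z * z) \<le> 1 * (z * z * z)" using z by (intro mult_right_mono) auto
  moreover have "(1 + t) * (z * (z * z * z)) \<le> 2 * (z * (z * z * z))" using z t' by (intro mult_right_mono) auto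
  ultimately have "0 \<le> (1 - t) - (4 * t0 - 2 * t) * (z * z) + 4 * (z * z * z) - (1 + t) * (z * (z * z * z))"
    using p(3) by (simp add: algebra_simps)
  also have "\<dots> = (1 - z * z + 2 * z) * (1 + z * z) - (1 - z * z) * (2 * z) - t0 * ((2 * z) * (2 * z)) - t * ((1 - z * z) * (1 - z * z))"
    by (simp add: algebra_simps)
  also have "\<dots> = (c * N + s * N) * N - (c * N) * (s * N) - t0 * ((s * N) * (s * N)) - t * ((c * N) * (c * N))"
    unfolding cN sN by (simp add: N_def power2_eq_square)
  also have "\<dots> = (c + s - (c * s + t0 * (s * s) + t * (c * c))) * (N * N)" by (simp add: algebra_simps)
  finally have "c * s + t0 * (s * s) + t * (c * c) \<le> c + s" using mult_pos_pos[OF N N] by (auto simp: zero_le_mult_iff)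
  moreover have "t' * (c * c) \<le> t * (c * c)" using t' by (intro mult_right_mono) auto
  ultimately show ?thesis by linarith
qed

text \<open>The claim is \<open>(1 - s) * (1 - c) \<le> 1 - t\<close>. From
  \<open>1 - s \<le> d * c\<close> and \<open>c * c = (1 - s) * (1 + s)\<close> comes
  \<open>c \<le> 2 * d\<close>, so the product is at most \<open>2 * (d * d)\<close>.\<close>

lemma extension_ineq2:
  fixes c s :: real
  assumes cs: "0 \<le> c" "0 \<le> s" "c * c + s * s = 1" and d: "0 \<le> d" "2 * (d * d) \<le> 1 - t" and h: "1 \<le> s + d * c"
  shows "t + c * s \<le> c + s"
proof -
  have w: "c \<le> 1" "s \<le> 1" using trig_pair[OF cs] by simp_all
  have "c * c = (1 - s) * (1 + s)" using cs(3) by (simp add: algebra_simps)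
  also have "\<dots> \<le> (d * c) * 2" using h w cs by (intro mult_mono) auto
  finally have "c * c \<le> (2 * d) * c" by (simp add: mult_ac)
  then have c: "c \<le> 2 * d" using cs(1) d by (cases "c = 0") auto
  have "(1 - s) * (1 - c) \<le> (d * c) * 1" using h w cs d by (intro mult_mono) auto
  also have "\<dots> \<le> 2 * (d * d)" using mult_left_mono[OF c d(1)] by simp
  finally show ?thesis using d(2) by (simp add: algebra_simps)
qed

lemma near_centre:
  assumes cs: "c * c + s * s = 1" and r: "1 < r"
    and d: "(a - cenx r c s k m) * (a - cenx r c s k m) + (b - ceny r c s k m) * (b - ceny r c s k m) \<le> 1 / 4"
  shows "inb r c s k m a b"
proof -
  let ?p = "a - cenx r c s k m" and ?q = "b - ceny r c s k m"
  have "(2 * ?p) * (2 * ?p) + (2 * ?q) * (2 * ?q) \<le> 1" using d by (simp add: algebra_simps)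
  from rotated_difference[OF cs this] have "\<bar>?p * c + ?q * s\<bar> \<le> 1 / 2" "\<bar>?q * c - ?p * s\<bar> \<le> 1 / 2" by linarith+
  moreover have "?p * c + ?q * s = a * c + b * s - (k + r / 2)" "?q * c - ?p * s = b * c - a * s - (m + r / 2)"
    using centre_e[OF cs, of r k m] centre_n[OF cs, of r k m] by (simp_all add: algebra_simps)
  ultimately show ?thesis unfolding inb_iff using r by simp
qed

text \<open>\<open>1780 / 1000\<close> is the height of the second row when the lowest is at
  \<open>914 / 1000\<close>. A centre above the lowest row exceeds it by less than
  \<open>1 / 10\<close>; it is then so close to an end point that the inscribed disc contains it, or
  it lies in the triangle.\<close>

lemma bottom_row_hit:
  assumes f: "fitting r c s k m" and x: "x0 \<le> cenx r c s k m" "cenx r c s k m \<le> x0 + 1" and y: "ceny r c s k m \<le> 1"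
  shows "inb r c s k m x0 (914 / 1000) \<or> inb r c s k m (x0 + 1) (914 / 1000) \<or> inb r c s k m (x0 + 1 / 2) (1780 / 1000)"
proof -
  let ?x = "cenx r c s k m" and ?y = "ceny r c s k m"
  have cs: "0 \<le> c" "0 \<le> s" "c * c + s * s = 1" "1 < r" using f by (auto simp: fitting_def)
  show ?thesis
  proof (cases "?y \<le> 914 / 1000")
    case True
    have "inb r c s k m x0 (914 / 1000) \<or> inb r c s k m (x0 + 1) (914 / 1000)"
      by (rule edge_hit[OF f, of "?x - x0"])
        (use x True unit_edge_ineq[OF cs(1-3), of "914 / 1000"] in \<open>simp_all add: field_simps\<close>)
    then show ?thesis by blast
  next
    case False
    define l where "l = (?y - 914 / 1000) / (866 / 1000)"
    have l: "0 \<le> l" "l \<le> 1 / 10" and yl: "?y = (1 - l) * (914 / 1000) + l * (1780 / 1000)"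
      using False y by (simp_all add: l_def field_simps)
    have dy: "\<bar>914 / 1000 - ?y\<bar> \<le> 1 / 10" using False y by simp
    have sq: "\<bar>e\<bar> \<le> p \<Longrightarrow> e * e \<le> p * p" for e p :: real using mult_mono[of "\<bar>e\<bar>" p "\<bar>e\<bar>" p] by simp
    consider "?x \<le> x0 + 2 / 10" | "x0 + 8 / 10 \<le> ?x" | "x0 + 2 / 10 \<le> ?x" "?x \<le> x0 + 8 / 10" by linarith
    then show ?thesis
    proof cases
      case 1
      then have "\<bar>x0 - ?x\<bar> \<le> 2 / 10" using x by simp
      from sq[OF this] sq[OF dy] near_centre[OF cs(3,4), of x0 k m "914 / 1000"] show ?thesis by simp
    next
      case 2
      then have "\<bar>x0 + 1 - ?x\<bar> \<le> 2 / 10" using x by simp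
      from sq[OF this] sq[OF dy] near_centre[OF cs(3,4), of "x0 + 1" k m "914 / 1000"] show ?thesis by simp
    next
      case 3
      show ?thesis
        by (rule strip_triangle_4[OF f _ _ _ yl]) (use l 3 in auto)
    qed
  qed
qed

definition tracks :: "real \<Rightarrow> real \<Rightarrow> real \<Rightarrow> real \<Rightarrow> real \<Rightarrow> real \<Rightarrow> bool" where
  "tracks r c s k m t1 \<longleftrightarrow> (\<exists>i\<in>Idx. \<forall>t. 1536 / 1000 - t1 \<le> t \<and> t \<le> t1 \<longrightarrow>
     (\<forall>u j. 0 \<le> u \<longrightarrow> u \<le> 4 / 10 \<longrightarrow> j \<in> Idx \<longrightarrow> inb r c s k m (fst (pt t u j)) (snd (pt t u j)) \<longleftrightarrow> j = i))"

lemma tracks_refly: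
  assumes "tracks r c s k m t1"
  shows "tracks r s c (5 * c - m - r) (5 * s - k - r) t1"
proof -
  obtain i where i: "i \<in> Idx" and *: "\<And>t u j. 1536 / 1000 - t1 \<le> t \<Longrightarrow> t \<le> t1 \<Longrightarrow> 0 \<le> u \<Longrightarrow> u \<le> 4 / 10 \<Longrightarrow> j \<in> Idx \<Longrightarrow>
      inb r c s k m (fst (pt t u j)) (snd (pt t u j)) \<longleftrightarrow> j = i"
    using assms by (auto simp: tracks_def)
  have ff: "flip (flip j) = j" if "j \<in> Idx" for j using that by (auto simp: Idx_def flip_def)
  have "inb r s c (5 * c - m - r) (5 * s - k - r) (fst (pt t u j)) (snd (pt t u j)) \<longleftrightarrow> j = flip i"
    if t: "1536 / 1000 - t1 \<le> t" "t \<le> t1" and u: "0 \<le> u" "u \<le> 4 / 10" and j: "j \<in> Idx" for t u j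
  proof -
    have "pt t u j = (fst (pt (1536 / 1000 - t) u (flip j)), 5 - snd (pt (1536 / 1000 - t) u (flip j)))"
      using pt_flip[OF flip_Idx[OF j]] ff[OF j] by simp
    then have "inb r s c (5 * c - m - r) (5 * s - k - r) (fst (pt t u j)) (snd (pt t u j)) \<longleftrightarrow>
        inb r c s k m (fst (pt (1536 / 1000 - t) u (flip j))) (snd (pt (1536 / 1000 - t) u (flip j)))"
      by (simp add: inb_refly)
    also have "\<dots> \<longleftrightarrow> flip j = i" by (rule *) (use t u flip_Idx[OF j] in simp_all)
    also have "\<dots> \<longleftrightarrow> j = flip i" using ff i j by metis
    finally show ?thesis .
  qed
  then show ?thesis unfolding tracks_def using flip_Idx[OF i] by blast
qed

text \<open>A box missed by the rows at height \<open>t\<close> whose centre lies below the lowest row is hit by the lowest row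
  at height \<open>914 / 1000\<close>. Hence it contains the segment swept so far by one point of that row and avoids those swept by its
  neighbours, which is incompatible with its position relative to the row at height \<open>t\<close>.\<close>

lemma hits_extension:
  assumes f: "fitting r c s k m" and tr: "tracks r c s k m t1" and u: "0 \<le> u" "u \<le> 4 / 10"
    and t: "914 / 1000 \<le> t1" "t1 \<le> t" "t \<le> t2" "t2 \<le> 1"
    and p: "0 \<le> p" "4 * (1536 / 1000 - t1) - 2 * t2 \<le> 3 * p" "p * p * p \<le> 1 - t2" "2 * ((t2 - t1) * (t2 - t1)) \<le> 1 - t2"
  shows "hits r c s k m t u"
proof (cases "ceny r c s k m < t")
  case False
  then show ?thesis using hits_lattice[OF f u] t by auto
next
  case True
  let ?x = "cenx r c s k m"
  have cs: "0 \<le> c" "0 \<le> s" "c * c + s * s = 1" "s * s + c * c = 1" and r: "1 < r" and bottom: "0 \<le> k * s + m * c" "0 \<le> m * c + k * s"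
    using f by (auto simp: fitting_def)
  obtain i where i: "i \<in> Idx" and *: "\<And>t u j. 1536 / 1000 - t1 \<le> t \<Longrightarrow> t \<le> t1 \<Longrightarrow> 0 \<le> u \<Longrightarrow> u \<le> 4 / 10 \<Longrightarrow> j \<in> Idx \<Longrightarrow>
      inb r c s k m (fst (pt t u j)) (snd (pt t u j)) \<longleftrightarrow> j = i"
    using tr by (auto simp: tracks_def)
  have row: "inb r c s k m (real j + 1) y \<longleftrightarrow> (0, j) = i" if "1536 / 1000 - t1 \<le> y" "y \<le> t1" "j < 4" for j y
    using *[OF that(1,2), of 0 "(0, j)"] that(3) by (simp add: Idx_def pt_def)
  define t0 where "t0 = 1536 / 1000 - t1"
  have d: "0 \<le> t2 - t1" using t by simp
  have in1: "c' * s' + t0 * (s' * s') + t * (c' * c') \<le> c' + s'" if "0 \<le> c'" "0 \<le> s'" "c' * c' + s' * s' = 1" for c' s' :: real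
    by (rule extension_ineq1[OF that p(1), of t0 t2]) (use p t in \<open>simp_all add: t0_def\<close>)
  have in2: "t + c' * s' \<le> c' + s'" if "0 \<le> c'" "0 \<le> s'" "c' * c' + s' * s' = 1" "1 \<le> s' + (t - t1) * c'" for c' s' :: real
  proof -
    have "(t - t1) * (t - t1) \<le> (t2 - t1) * (t2 - t1)" using t by (intro mult_mono) auto
    then show ?thesis by (intro extension_ineq2[OF that(1-3) _ _ that(4)]) (use p t in simp_all)
  qed
  have edge: "inb r c s k m (real j + 1) t \<or> inb r c s k m (real j + 1 + 1) t"
    if j: "j < 3" "real j + 1 \<le> ?x" "?x \<le> real j + 1 + 1" for j
  proof (rule ccontr)
    assume "\<not> ?thesis"
    then have NE: "m + r \<le> t * c - (real j + 1) * s" "k + r \<le> (real j + 1 + 1) * c + t * s"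
      using edge_exits[OF f, of "?x - (real j + 1)" "real j + 1" "real j + 1 + 1" t t] True t j
      by (simp_all add: algebra_simps)
    \<comment> \<open>The upper sides pass below points at height at most 1, so the point of the
      second row halfway between these is out of reach: the two inequalities add up to
      \<open>780 / 1000 * (c + s) < 1 / 2 * (c + s)\<close>.\<close>
    have nb: "\<not> inb r c s k m (real j + 1 + 1 / 2) (1780 / 1000)"
    proof
      assume "inb r c s k m (real j + 1 + 1 / 2) (1780 / 1000)"
      then have "(780 / 1000) * s < (1 / 2) * c + (t - 1) * s" "(780 / 1000) * c < (1 / 2) * s + (t - 1) * c"
        using NE by (simp_all add: inb_def algebra_simps)
      moreover have "(t - 1) * s \<le> 0" "(t - 1) * c \<le> 0" using t cs by (simp_all add: mult_nonpos_nonneg)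
      ultimately show False using cs by linarith
    qed
    have "ceny r c s k m \<le> 1" using True t by simp
    from bottom_row_hit[OF f j(2,3) this] nb
    consider "inb r c s k m (real j + 1) (914 / 1000)" | "inb r c s k m (real (Suc j) + 1) (914 / 1000)" by (auto simp: algebra_simps)
    then show False
    proof cases
      case 1
      then have i: "i = (0, j)" using row[of "914 / 1000" j] j t by simp
      show False
      proof (rule extension_core[OF r cs(1-3) bottom(1) NE, of t0 t1])
        show "inb r c s k m (real j + 1) y" if "t0 \<le> y" "y \<le> t1" for y using row[of y j] that j i by (simp add: t0_def)
        show "\<not> inb r c s k m (real j + 1 + 1) y" if "t0 \<le> y" "y \<le> t1" for y
          using row[of y "Suc j"] that j i by (simp add: t0_def algebra_simps)
      qed (use t in1[OF cs(1-3)] in2[OF cs(1-3)] in \<open>simp_all add: t0_def\<close>)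
    next
      case 2
      then have i: "i = (0, Suc j)" using row[of "914 / 1000" "Suc j"] j t by simp
      \<comment> \<open>The other neighbour is handled by reflecting in the vertical axis through
        the origin. This moves the box out of the square sideways, but \<open>extension_core\<close>
        refers only to the bottom side.\<close>
      have mirror: "inb r s c m k (- a) b \<longleftrightarrow> inb r c s k m a b" for a b by (auto simp: inb_def algebra_simps)
      show False
      proof (rule extension_core[OF r cs(2,1,4) bottom(2), of t "- (real j + 1 + 1)" t0 t1])
        show "inb r s c m k (- (real j + 1 + 1)) y" if "t0 \<le> y" "y \<le> t1" for y
          using row[of y "Suc j"] that j i mirror[of "real j + 1 + 1" y] by (simp add: t0_def algebra_simps)
        show "\<not> inb r s c m k (- (real j + 1 + 1) + 1) y" if "t0 \<le> y" "y \<le> t1" for y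
          using row[of y j] that j i mirror[of "real j + 1" y] by (simp add: t0_def algebra_simps)
        show "k + r \<le> t * s - - (real j + 1 + 1) * c" "m + r \<le> (- (real j + 1 + 1) + 1) * s + t * c"
          using NE by (simp_all add: algebra_simps)
      qed (use t in1[OF cs(2,1,4)] in2[OF cs(2,1,4)] in \<open>simp_all add: t0_def\<close>)
    qed
  qed
  have right: "inb r c s k m 4 t" if "4 \<le> ?x"
  proof -
    have "inb r s c (5 * s + m) (k - 5 * c) 1 t"
      by (rule corner_hit[OF fitting_reflx[OF f]]) (use that t True in \<open>simp_all add: cenx_reflx[OF cs(3)] ceny_reflx\<close>)
    then show ?thesis using inb_reflx[of r s c m k 4 t] by simp
  qed
  have "inb r c s k m 1 t \<or> inb r c s k m 2 t \<or> inb r c s k m 3 t \<or> inb r c s k m 4 t"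
  proof -
    consider "?x \<le> 1" | "1 \<le> ?x" "?x \<le> 2" | "2 \<le> ?x" "?x \<le> 3" | "3 \<le> ?x" "?x \<le> 4" | "4 \<le> ?x" by linarith
    then show ?thesis
    proof cases
      case 1 then show ?thesis using corner_hit[OF f 1, of t] True t by simp
    next
      case 2 then show ?thesis using edge[of 0] by auto
    next
      case 3 then show ?thesis using edge[of 1] by auto
    next
      case 4 then show ?thesis using edge[of 2] by auto
    next
      case 5 then show ?thesis using right by simp
    qed
  qed
  then show ?thesis using hits_row4[of 0 t t] by simp
qed

lemma hits_extension_symmetric:
  assumes f: "fitting r c s k m" and tr: "tracks r c s k m t1" and u: "0 \<le> u" "u \<le> 4 / 10"
    and t: "914 / 1000 \<le> t1" "t1 \<le> t2" "t2 \<le> 1" "1536 / 1000 - t2 \<le> t" "t \<le> t2"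
    and p: "0 \<le> p" "4 * (1536 / 1000 - t1) - 2 * t2 \<le> 3 * p" "p * p * p \<le> 1 - t2" "2 * ((t2 - t1) * (t2 - t1)) \<le> 1 - t2"
  shows "hits r c s k m t u"
proof -
  consider "t1 \<le> t" | "t1 \<le> 1536 / 1000 - t" | "1536 / 1000 - t1 \<le> t" "t \<le> t1" by linarith
  then show ?thesis
  proof cases
    case 1 then show ?thesis using hits_extension[OF f tr u t(1) _ t(5,3) p] by simp
  next
    case 2
    then have "hits r s c (5 * c - m - r) (5 * s - k - r) (1536 / 1000 - t) u"
      using hits_extension[OF fitting_refly[OF f] tracks_refly[OF tr] u t(1) _ _ t(3) p] t by simp
    then show ?thesis by (rule hits_refly)
  next
    case 3
    then show ?thesis using tr u unfolding tracks_def hits_def by blast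
  qed
qed

text \<open>For fixed \<open>x\<close> each set picks a point, disjoint sets pick different points,
  and equal cardinalities make this a bijection; so every point lies in some set. For fixed
  \<open>i\<close> the parameters for which \<open>p x i\<close> lies in a given set form an open
  set with open complement, and connectedness leaves one set for all \<open>x\<close>.\<close>

lemma tracking:
  fixes p :: "'a::topological_space \<Rightarrow> 'i \<Rightarrow> 'b::topological_space"
  assumes fin: "finite I" "finite J" "card I = card J" and S: "connected S" "S \<noteq> {}"
    and cont: "\<And>i. i \<in> J \<Longrightarrow> continuous_on S (\<lambda>x. p x i)"
    and op: "\<And>B. B \<in> I \<Longrightarrow> open B" and dis: "\<And>B C. B \<in> I \<Longrightarrow> C \<in> I \<Longrightarrow> B \<noteq> C \<Longrightarrow> B \<inter> C = {}"
    and hit: "\<And>x B. x \<in> S \<Longrightarrow> B \<in> I \<Longrightarrow> \<exists>i\<in>J. p x i \<in> B"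
  shows "\<exists>F. bij_betw F J I \<and> (\<forall>i\<in>J. \<forall>x\<in>S. p x i \<in> F i)"
proof -
  have cover: "\<exists>B\<in>I. p x i \<in> B" if "x \<in> S" "i \<in> J" for x i
  proof -
    define g where "g B = (SOME i. i \<in> J \<and> p x i \<in> B)" for B
    have g: "g B \<in> J" "p x (g B) \<in> B" if "B \<in> I" for B
      using hit[OF \<open>x \<in> S\<close> that] unfolding g_def by (metis (mono_tags, lifting) someI_ex)+
    have "inj_on g I"
    proof (rule inj_onI)
      fix B C assume "B \<in> I" "C \<in> I" "g B = g C"
      then show "B = C" using g[of B] g[of C] dis[of B C] by auto
    qed
    then have "card (g ` I) = card J" using fin by (simp add: card_image)
    then have "g ` I = J" using g(1) fin(2) by (intro card_subset_eq) auto
    then show ?thesis using g(2) that by blast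
  qed
  have const: "\<exists>B\<in>I. \<forall>x\<in>S. p x i \<in> B" if i: "i \<in> J" for i
  proof -
    obtain x0 where x0: "x0 \<in> S" using S by auto
    obtain B where B: "B \<in> I" "p x0 i \<in> B" using cover[OF x0 i] by blast
    define T where "T = {x \<in> S. p x i \<in> B}"
    have o: "openin (top_of_set S) {x \<in> S. p x i \<in> C}" if "open C" for C
      using continuous_openin_preimage_gen[OF cont[OF i] that] by (simp add: vimage_def Int_def)
    have "S - T = {x \<in> S. p x i \<in> \<Union>(I - {B})}"
    proof (rule set_eqI)
      fix x show "x \<in> S - T \<longleftrightarrow> x \<in> {x \<in> S. p x i \<in> \<Union>(I - {B})}"
        using cover[of x i] i B dis[of B] unfolding T_def by blast
    qed
    moreover have "open (\<Union>(I - {B}))" using op by auto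
    ultimately have "openin (top_of_set S) (S - T)" using o by metis
    moreover have "openin (top_of_set S) T" unfolding T_def using o op B by blast
    moreover have "T \<subseteq> S" by (auto simp: T_def)
    ultimately have "T = {} \<or> T = S" using S(1) unfolding connected_clopen closedin_def by auto
    moreover have "x0 \<in> T" using x0 B by (simp add: T_def)
    ultimately show ?thesis using B by (auto simp: T_def)
  qed
  define F where "F i = (SOME B. B \<in> I \<and> (\<forall>x\<in>S. p x i \<in> B))" for i
  have F: "F i \<in> I" "\<And>x. x \<in> S \<Longrightarrow> p x i \<in> F i" if "i \<in> J" for i
    using someI_ex[of "\<lambda>B. B \<in> I \<and> (\<forall>x\<in>S. p x i \<in> B)"] const[OF that] unfolding F_def by blast+
  obtain x0 where x0: "x0 \<in> S" using S by auto
  have "F ` J = I"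
  proof
    show "F ` J \<subseteq> I" using F by auto
    show "I \<subseteq> F ` J"
    proof
      fix B assume B: "B \<in> I"
      then obtain i where i: "i \<in> J" "p x0 i \<in> B" using hit[OF x0] by blast
      then have "B = F i" using F[OF i(1)] x0 dis[of B "F i"] B by blast
      then show "B \<in> F ` J" using i by blast
    qed
  qed
  moreover from this have "inj_on F J" using fin by (intro eq_card_imp_inj_on) auto
  ultimately show ?thesis using F unfolding bij_betw_def by blast
qed

section \<open>Boxes as open sets and the range of their labels\<close>

definition is_box :: "real \<Rightarrow> (real \<times> real) set \<Rightarrow> bool" where
  "is_box r B \<longleftrightarrow> (\<exists>c s k m. fitting r c s k m \<and> B = {(a, b). inb r c s k m a b})"

lemma is_boxE:
  assumes "is_box r B"
  obtains c s k m where "fitting r c s k m" "\<And>a b. (a, b) \<in> B \<longleftrightarrow> inb r c s k m a b"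
  using assms unfolding is_box_def by blast

lemma is_box_open:
  assumes "is_box r B"
  shows "open B"
proof -
  obtain c s k m where "B = {(a, b). inb r c s k m a b}" using assms by (auto simp: is_box_def)
  then have "B = {p. k < fst p * c + snd p * s \<and> fst p * c + snd p * s < k + r \<and>
     m < snd p * c - fst p * s \<and> snd p * c - fst p * s < m + r}" by (auto simp: inb_def)
  then show ?thesis by (simp only:) (intro open_Collect_conj open_Collect_less continuous_intros)
qed

text \<open>The squared diameter is at most \<open>2 * r * r\<close>; the upper bound on
  \<open>r\<close> in \<open>fitting\<close> serves this estimate.\<close>

lemma box_diameter:
  assumes "is_box r B" "(a, b) \<in> B" "(a', b') \<in> B"
  shows "(a - a') * (a - a') + (b - b') * (b - b') < 21 / 10"
proof -
  obtain c s k m where f: "fitting r c s k m" and B: "\<And>a b. (a, b) \<in> B \<longleftrightarrow> inb r c s k m a b"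
    using is_boxE[OF assms(1)] by blast
  then have r: "1 < r" "r < 1001 / 1000" and cs: "c * c + s * s = 1" by (auto simp: fitting_def)
  define p where "p = (a - a') * c + (b - b') * s"
  define q where "q = (b - b') * c - (a - a') * s"
  have "\<bar>p\<bar> \<le> 1001 / 1000" "\<bar>q\<bar> \<le> 1001 / 1000"
    using assms(2,3) r unfolding B inb_def p_def q_def left_diff_distrib by linarith+
  then have "p * p \<le> (1001 / 1000) * (1001 / 1000)" "q * q \<le> (1001 / 1000) * (1001 / 1000)"
    using mult_mono[of "\<bar>p\<bar>" "1001 / 1000" "\<bar>p\<bar>" "1001 / 1000"] mult_mono[of "\<bar>q\<bar>" "1001 / 1000" "\<bar>q\<bar>" "1001 / 1000"] by simp_all
  moreover have "p * p + q * q = ((a - a') * (a - a') + (b - b') * (b - b')) * (c * c + s * s)"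
    unfolding p_def q_def by (simp add: algebra_simps)
  ultimately show ?thesis using cs by simp
qed

lemma Idx_eq: "Idx = {(0, 0), (0, 1), (0, 2), (0, 3), (1, 0), (1, 1), (1, 2), (1, 3), (1, 4), (2, 0), (2, 1), (2, 2), (2, 3),
    (3, 0), (3, 1), (3, 2), (3, 3), (3, 4), (4, 0), (4, 1), (4, 2), (4, 3)}" (is "_ = ?R")
proof (rule set_eqI)
  fix x :: "nat \<times> nat"
  obtain i j where x: "x = (i, j)" by (cases x)
  consider "i = 0" | "i = 1" | "i = 2" | "i = 3" | "i = 4" | "5 \<le> i" by linarith
  then show "x \<in> Idx \<longleftrightarrow> x \<in> ?R" unfolding x Idx_def by cases (simp_all, auto)
qed

lemma card_Idx: "finite Idx" "card Idx = 22"
  by (simp_all add: Idx_eq)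

definition tracked :: "(real \<times> real) set set \<Rightarrow> (nat \<times> nat \<Rightarrow> (real \<times> real) set) \<Rightarrow> real \<Rightarrow> bool" where
  "tracked I F t1 \<longleftrightarrow> bij_betw F Idx I \<and>
     (\<forall>i\<in>Idx. \<forall>t u. 1536 / 1000 - t1 \<le> t \<longrightarrow> t \<le> t1 \<longrightarrow> 0 \<le> u \<longrightarrow> u \<le> 4 / 10 \<longrightarrow> pt t u i \<in> F i)"

definition disjoint_boxes :: "real \<Rightarrow> (real \<times> real) set set \<Rightarrow> bool" where
  "disjoint_boxes r I \<longleftrightarrow> finite I \<and> card I = 22 \<and> (\<forall>B\<in>I. is_box r B) \<and> (\<forall>B\<in>I. \<forall>C\<in>I. B \<noteq> C \<longrightarrow> B \<inter> C = {})"

text \<open>The parameters form a rectangle. Varying \<open>u\<close> together with \<open>t\<close>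
  also puts horizontal segments, at the ends of the rows of five, into the boxes.\<close>

lemma exists_tracked:
  assumes I: "disjoint_boxes r I" and t1: "768 / 1000 \<le> t1"
    and hit: "\<And>c s k m t u. {(a, b). inb r c s k m a b} \<in> I \<Longrightarrow> fitting r c s k m \<Longrightarrow> 1536 / 1000 - t1 \<le> t \<Longrightarrow> t \<le> t1 \<Longrightarrow>
      0 \<le> u \<Longrightarrow> u \<le> 4 / 10 \<Longrightarrow> hits r c s k m t u"
  shows "\<exists>F. tracked I F t1"
proof -
  define S where "S = {1536 / 1000 - t1..t1} \<times> {0..4 / 10 :: real}"
  have "\<exists>F. bij_betw F Idx I \<and> (\<forall>i\<in>Idx. \<forall>x\<in>S. pt (fst x) (snd x) i \<in> F i)"
  proof (rule tracking)
    show "finite I" "finite Idx" "card I = card Idx" using I by (simp_all add: disjoint_boxes_def card_Idx)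
    have "convex S" unfolding S_def by (intro convex_Times) auto
    then show "connected S" by (rule convex_connected)
    show "S \<noteq> {}" using t1 by (auto simp: S_def)
    show "continuous_on S (\<lambda>x. pt (fst x) (snd x) i)" for i
    proof -
      obtain a b where i: "i = (a, b)" by (cases i)
      consider "even a" | "odd a" "b = 0" | "odd a" "b = 4" | "odd a" "b \<noteq> 0" "b \<noteq> 4" by blast
      then show ?thesis by cases (auto simp: i pt_def intro!: continuous_intros)
    qed
    show "\<And>B. B \<in> I \<Longrightarrow> open B" using I is_box_open by (auto simp: disjoint_boxes_def)
    show "\<And>B C. B \<in> I \<Longrightarrow> C \<in> I \<Longrightarrow> B \<noteq> C \<Longrightarrow> B \<inter> C = {}" using I by (auto simp: disjoint_boxes_def)
    fix x B assume x: "x \<in> S" and B: "B \<in> I"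
    have "is_box r B" using I B by (simp add: disjoint_boxes_def)
    then obtain c s k m where f: "fitting r c s k m" and Beq: "B = {(a, b). inb r c s k m a b}"
      unfolding is_box_def by blast
    have "hits r c s k m (fst x) (snd x)"
      by (rule hit[OF B[unfolded Beq] f]) (use x in \<open>auto simp: S_def\<close>)
    then show "\<exists>i\<in>Idx. pt (fst x) (snd x) i \<in> B" unfolding hits_def Beq by (simp add: case_prod_beta)
  qed
  then obtain F where F: "bij_betw F Idx I" "\<And>i x. i \<in> Idx \<Longrightarrow> x \<in> S \<Longrightarrow> pt (fst x) (snd x) i \<in> F i" by blast
  have "pt t u i \<in> F i" if "i \<in> Idx" "1536 / 1000 - t1 \<le> t" "t \<le> t1" "0 \<le> u" "u \<le> 4 / 10" for i t u
    using F(2)[OF that(1), of "(t, u)"] that by (simp add: S_def)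
  with F(1) show ?thesis unfolding tracked_def by blast
qed

lemma tracked_tracks:
  assumes I: "disjoint_boxes r I" and F: "tracked I F t1" and B: "{(a, b). inb r c s k m a b} \<in> I"
  shows "tracks r c s k m t1"
proof -
  let ?B = "{(a, b). inb r c s k m a b}"
  obtain i where i: "i \<in> Idx" "F i = ?B" using F B by (auto simp: tracked_def bij_betw_def)
  have "inb r c s k m (fst (pt t u j)) (snd (pt t u j)) \<longleftrightarrow> j = i"
    if "1536 / 1000 - t1 \<le> t" "t \<le> t1" "0 \<le> u" "u \<le> 4 / 10" "j \<in> Idx" for t u j
  proof
    have p: "pt t u j \<in> F j" using F that by (simp add: tracked_def)
    show "j = i \<Longrightarrow> inb r c s k m (fst (pt t u j)) (snd (pt t u j))" using p i by (auto simp: case_prod_beta)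
    assume "inb r c s k m (fst (pt t u j)) (snd (pt t u j))"
    then have "pt t u j \<in> F i" using i by (simp add: case_prod_beta)
    moreover have "F i \<in> I" "F j \<in> I" using F i that by (auto simp: tracked_def bij_betw_def)
    ultimately have "F i = F j" using p I unfolding disjoint_boxes_def by blast
    then show "j = i" using F i that unfolding tracked_def bij_betw_def inj_on_def by metis
  qed
  then show ?thesis unfolding tracks_def using i by blast
qed

lemma tracked_extension:
  assumes I: "disjoint_boxes r I" and F: "tracked I F t1" and t: "914 / 1000 \<le> t1" "t1 \<le> t2" "t2 \<le> 1"
    and p: "0 \<le> p" "4 * (1536 / 1000 - t1) - 2 * t2 \<le> 3 * p" "p * p * p \<le> 1 - t2" "2 * ((t2 - t1) * (t2 - t1)) \<le> 1 - t2"
  shows "\<exists>F. tracked I F t2"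
proof (rule exists_tracked[OF I])
  show "768 / 1000 \<le> t2" using t by simp
  show "hits r c s k m t u" if "{(a, b). inb r c s k m a b} \<in> I" "fitting r c s k m" "1536 / 1000 - t2 \<le> t" "t \<le> t2"
    "0 \<le> u" "u \<le> 4 / 10" for c s k m t u
    using hits_extension_symmetric[OF that(2) tracked_tracks[OF I F that(1)] that(5,6) t that(3,4) p] .
qed

lemma tracked_995:
  assumes I: "disjoint_boxes r I"
  shows "\<exists>F. tracked I F (995 / 1000)"
proof -
  have "\<exists>F. tracked I F (914 / 1000)"
    by (rule exists_tracked[OF I]) (auto intro: hits_lattice)
  then obtain F where "tracked I F (914 / 1000)" by blast
  \<comment> \<open>Two steps, because \<open>2 * ((t2 - t1) * (t2 - t1)) \<le> 1 - t2\<close> fails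
    for a direct step from \<open>914 / 1000\<close> to \<open>995 / 1000\<close>. The last argument
    is the double root \<open>p\<close>. The final range starts at
    \<open>541 / 1000 = 1536 / 1000 - 995 / 1000\<close>.\<close>
  from tracked_extension[OF I this, of "97 / 100" "2 / 10"] obtain G where "tracked I G (97 / 100)" by auto
  from tracked_extension[OF I this, of "995 / 1000" "1 / 10"] show ?thesis by simp
qed

section \<open>Boxes labelled by rows and columns\<close>

text \<open>Cauchy-Schwarz; it serves to show that two points at distance less than 1 are not
  separated by two opposite sides of a box.\<close>

lemma linear_form_less_1:
  fixes c s :: real
  assumes "c * c + s * s = 1" "p * p + q * q < 1"
  shows "p * c + q * s < 1"
proof -
  have "(p * c + q * s) * (p * c + q * s) + (p * s - q * c) * (p * s - q * c) = (p * p + q * q) * (c * c + s * s)"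
    by (simp add: algebra_simps)
  moreover have "(p * c + q * s) * (p * c + q * s) \<le> (p * c + q * s) * (p * c + q * s) + (p * s - q * c) * (p * s - q * c)" by simp
  ultimately have "(p * c + q * s) * (p * c + q * s) < 1" using assms by simp
  then have "\<not> 1 \<le> p * c + q * s" using mult_mono[of 1 "p * c + q * s" 1 "p * c + q * s"] by auto
  then show ?thesis by simp
qed

text \<open>The names of the following lemmas refer to rows a, b, c counted from below and columns A, B, C counted from the
  left: b1A1 is the box tracked by the first point of row b and by the first point of column A. The numbers \<open>1407/1000\<close>,
  \<open>1861/1000\<close> and \<open>2273/1000\<close>, \<open>2727/1000\<close> are the extreme positions of the second and third row.\<close>

lemma box_b1A1:
  assumes "is_box r B" and i: "(1/2, 1861/1000) \<in> B" "(9/10, 1861/1000) \<in> B" "(9/10, 7/4) \<in> B" "(541/1000, 1) \<in> B" "(995/1000, 1) \<in> B"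
  shows "(1, 7/4) \<in> B"
proof (rule ccontr)
  assume o: "(1, 7/4) \<notin> B"
  obtain c s k m where f: "fitting r c s k m" and B: "\<And>a b. (a, b) \<in> B \<longleftrightarrow> inb r c s k m a b"
    using is_boxE[OF assms(1)] by blast
  have cs: "0 \<le> c" "0 \<le> s" "c * c + s * s = 1" and r: "1 < r" and left: "0 \<le> k * c - (m + r) * s" using f by (auto simp: fitting_def)
  note w = trig_pair[OF cs]
  note i = i[unfolded B inb_def] and o = o[unfolded B inb_def]
  \<comment> \<open>The missed point is beyond the upper right or the lower right side. In both
    cases the points known to be inside bound \<open>k\<close> above and \<open>m + r\<close> below
    so far that the abscissa \<open>k * c - (m + r) * s\<close> of the left vertex becomes
    negative.\<close>
  have "k + r \<le> 1 * c + 7/4 * s \<or> 7/4 * c - 1 * s \<le> m" using o i cs(1,2) by linarith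
  then show False
  proof
    assume e: "k + r \<le> 1 * c + 7/4 * s"
    then have s: "111 * s < 100 * c" using i by linarith
    then have c0: "0 < c" using cs by linarith
    have "k * c \<le> (c + 7/4 * s - r) * c" using e c0 by (intro mult_right_mono) auto
    moreover have "(1861/1000 * c - 1/2 * s) * s \<le> (m + r) * s" using i cs by (intro mult_right_mono) auto
    moreover have "1 * c < r * c" using r c0 by simp
    ultimately have A: "111/1000 * (c * s) < c * c - c + 1/2 * (s * s)" using left by (simp add: algebra_simps)
    \<comment> \<open>The ratio of \<open>s\<close> to \<open>c\<close> is below
      \<open>100/111\<close>, an angle of about 42 degrees.\<close>
    have c74: "74/100 < c"
    proof (rule ccontr)
      assume "\<not> ?thesis"
      then have "c * c \<le> 74/100 * (74/100)" "s * s \<le> (100/111 * (74/100)) * (100/111 * (74/100))"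
        using s cs by (intro mult_mono; linarith)+
      then show False using cs(3) by simp
    qed
    have "(1 - c) * (174/100) \<le> (1 - c) * (1 + c)" using c74 w by (intro mult_left_mono) auto
    also have "\<dots> = s * s" using cs(3) by (simp add: algebra_simps)
    finally have B1: "(1 - c) * (174/100) \<le> s * s" .
    have "(1 - c) * (1 - c) \<le> (1 - c) * (26/100)" using c74 w by (intro mult_left_mono) auto
    then have B2: "1/2 * ((1 - c) * (1 - c)) \<le> 13/100 * (1 - c)" by linarith
    have "s * s \<le> (100/111 * c) * s" using s cs by (intro mult_right_mono) auto
    then have B3: "s * s \<le> 100/111 * (c * s)" by (simp only: mult.assoc)
    have "0 \<le> c * s" using cs by simp
    then have "1/2 * ((1 - c) * (1 - c)) \<le> 1/10 * (c * s)" using B1 B2 B3 by linarith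
    moreover have "c * c - c + 1/2 * (s * s) = 1/2 * ((1 - c) * (1 - c))" using cs(3) by (simp add: algebra_simps)
    moreover have "0 \<le> c * s" using cs by simp
    ultimately show False using A by linarith
  next
    assume n: "7/4 * c - 1 * s \<le> m"
    then have s: "150 * c < s" using i by linarith
    have "k * c \<le> (541/1000 * c + s) * c" using i cs by (intro mult_right_mono) auto
    moreover have "(7/4 * c - s + r) * s \<le> (m + r) * s" using n cs by (intro mult_right_mono) auto
    moreover have "0 < (r - s) * s" using r w s cs by (intro mult_pos_pos) auto
    ultimately have "3/4 * (c * s) < 541/1000 * (c * c)" using left by (simp add: algebra_simps)
    moreover have "c * c \<le> c * s" using s cs by (intro mult_left_mono) auto
    moreover have "0 \<le> c * c" by simp
    ultimately show False by linarith
  qed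
qed

text \<open>Again the left side of the square decides, now with the column points at height 2
  instead of 1 and the row point at its lower extreme \<open>1407/1000\<close>.\<close>

lemma box_b1A2:
  assumes "is_box r B" and i: "(1/2, 1407/1000) \<in> B" "(9/10, 1407/1000) \<in> B" "(9/10, 7/4) \<in> B" "(541/1000, 2) \<in> B" "(995/1000, 2) \<in> B"
  shows "(1, 7/4) \<in> B"
proof (rule ccontr)
  assume o: "(1, 7/4) \<notin> B"
  obtain c s k m where f: "fitting r c s k m" and B: "\<And>a b. (a, b) \<in> B \<longleftrightarrow> inb r c s k m a b"
    using is_boxE[OF assms(1)] by blast
  have cs: "0 \<le> c" "0 \<le> s" "c * c + s * s = 1" and r: "1 < r" and left: "0 \<le> k * c - (m + r) * s" using f by (auto simp: fitting_def)
  note w = trig_pair[OF cs]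
  note i = i[unfolded B inb_def] and o = o[unfolded B inb_def]
  have "k + r \<le> 1 * c + 7/4 * s \<or> 7/4 * c - 1 * s \<le> m" using o i cs(1,2) by linarith
  then show False
  proof
    assume e: "k + r \<le> 1 * c + 7/4 * s"
    then have s: "50 * s < c" using i by linarith
    then have c0: "0 < c" using cs by linarith
    have "k * c \<le> (c + 7/4 * s - r) * c" using e c0 by (intro mult_right_mono) auto
    moreover have "(2 * c - 541/1000 * s) * s \<le> (m + r) * s" using i cs by (intro mult_right_mono) auto
    moreover have "1 * c < r * c" using r c0 by simp
    moreover have "c * c \<le> 1 * c" using w c0 by (intro mult_right_mono) auto
    ultimately have A: "1/4 * (c * s) < 541/1000 * (s * s)" using left by (simp add: algebra_simps)
    have "(50 * s) * s \<le> c * s" using s cs by (intro mult_right_mono) auto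
    then show False using A zero_le_square[of s] by simp
  next
    assume n: "7/4 * c - 1 * s \<le> m"
    then have s: "343 * c < 100 * s" using i by linarith
    have "k * c \<le> (1/2 * c + 1407/1000 * s) * c" using i cs by (intro mult_right_mono) auto
    moreover have "(7/4 * c - s + r) * s \<le> (m + r) * s" using n cs by (intro mult_right_mono) auto
    moreover have "0 < (r - s) * s" using r w s cs by (intro mult_pos_pos) auto
    ultimately have "343/1000 * (c * s) < 1/2 * (c * c)" using left by (simp add: algebra_simps)
    moreover have "c * (343/100 * c) \<le> c * s" using s cs by (intro mult_left_mono) auto
    moreover have "0 \<le> c * c" by simp
    ultimately show False by simp
  qed
qed

text \<open>A box missing both points is pushed up by them, which the points inside forbid, or down.
  In the latter case \<open>lin\<close> keeps \<open>(3/2, 9/10)\<close>, which is less than 1 away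
  from both, from lying beyond the opposite sides, so the box would contain it.\<close>

lemma box_b2B2:
  assumes "is_box r B" and i: "(3/2, 7/4) \<in> B" "(3/2, 1861/1000) \<in> B" "(1407/1000, 3/2) \<in> B" "(1861/1000, 3/2) \<in> B"
    and n: "(3/2, 9/10) \<notin> B"
  shows "(1, 7/4) \<in> B \<or> (2, 7/4) \<in> B"
proof (rule ccontr)
  assume o: "\<not> ?thesis"
  obtain c s k m where f: "fitting r c s k m" and B: "\<And>a b. (a, b) \<in> B \<longleftrightarrow> inb r c s k m a b"
    using is_boxE[OF assms(1)] by blast
  have cs: "0 \<le> c" "0 \<le> s" "c * c + s * s = 1" and r: "1 < r" using f by (auto simp: fitting_def)
  note w = trig_pair[OF cs]
  have lin: "1/2 * c + 85/100 * s < 1" "85/100 * c + 1/2 * s < 1" by (rule linear_form_less_1[OF cs(3)]; simp)+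
  note i = i[unfolded B inb_def] and o = o[unfolded B inb_def] and n = n[unfolded B inb_def]
  have "1 * c + 7/4 * s \<le> k \<or> m + r \<le> 7/4 * c - 1 * s" using o i cs(1,2) by linarith
  moreover have "k + r \<le> 2 * c + 7/4 * s \<or> 7/4 * c - 2 * s \<le> m" using o i cs(1,2) by linarith
  ultimately show False using i n r w lin cs(1,2) by linarith
qed

text \<open>Missing \<open>(5/2, 1)\<close> and the points at height \<open>7/4\<close> lifts the
  box; the missed points at abscissas 2 and 3 then lie beyond its four sides, one for each. This
  confines \<open>k\<close> and \<open>m\<close> to short intervals and the centre to a small
  rectangle about \<open>(5/2, 201/100)\<close>.\<close>

lemma box_b3C2:
  assumes "is_box r B" and i: "(5/2, 1407/1000) \<in> B" "(5/2, 7/4) \<in> B" "(5/2, 1861/1000) \<in> B" "(2273/1000, 2) \<in> B" "(2727/1000, 2) \<in> B"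
    and n: "(5/2, 1) \<notin> B" "(2, 2273/1000) \<notin> B" "(3, 2273/1000) \<notin> B" "(2, 7/4) \<notin> B" "(3, 7/4) \<notin> B"
  shows "\<exists>x y. 244/100 \<le> x \<and> x \<le> 256/100 \<and> 195/100 \<le> y \<and> y \<le> 207/100 \<and>
    (\<forall>a b. (a - x) * (a - x) + (b - y) * (b - y) \<le> 1/4 \<longrightarrow> (a, b) \<in> B)"
proof -
  obtain c s k m where f: "fitting r c s k m" and B: "\<And>a b. (a, b) \<in> B \<longleftrightarrow> inb r c s k m a b"
    using is_boxE[OF assms(1)] by blast
  have cs: "0 \<le> c" "0 \<le> s" "c * c + s * s = 1" and r: "1 < r" using f by (auto simp: fitting_def)
  note w = trig_pair[OF cs]
  have lin: "1/2 * c + 3/4 * s < 1" "3/4 * c + 1/2 * s < 1" by (rule linear_form_less_1[OF cs(3)]; simp)+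
  note i = i[unfolded B inb_def] and n = n[unfolded B inb_def]
  have L: "2 * c + 7/4 * s \<le> k \<or> m + r \<le> 7/4 * c - 2 * s" using n(4) i cs(1,2) by linarith
  have R: "k + r \<le> 3 * c + 7/4 * s \<or> 7/4 * c - 3 * s \<le> m" using n(5) i cs(1,2) by linarith
  have raised: "2 * c + 7/4 * s \<le> k" "7/4 * c - 3 * s \<le> m"
    using L R i n(1) r w lin cs(1,2) by linarith+
  have L': "2 * c + 2273/1000 * s \<le> k \<or> m + r \<le> 2273/1000 * c - 2 * s" using n(2) i raised r w cs(1,2) by linarith
  have R': "k + r \<le> 3 * c + 2273/1000 * s \<or> 2273/1000 * c - 3 * s \<le> m" using n(3) i raised r w cs(1,2) by linarith
  have top: "k + r \<le> 3 * c + 2273/1000 * s" "m + r \<le> 2273/1000 * c - 2 * s" using L' R' i r w cs(1,2) by linarith+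
  define x y where "x = cenx r c s k m" and "y = ceny r c s k m"
  \<comment> \<open>\<open>c * s\<close> is a convex function of \<open>c + s\<close>, so it lies
    below its chord over [1, sqrt 2], whose slope is \<open>(1 + sqrt 2) / 2\<close>, here rounded
    up.\<close>
  have sc: "c * s \<le> 120711/100000 * (c + s - 1)"
  proof -
    have "0 \<le> (c + s - 1) * (141422/100000 - (c + s))" using w by simp
    moreover have "(c + s - 1) * (141422/100000 - (c + s)) = 241422/100000 * (c + s) - 141422/100000 - (c * c + s * s) - 2 * (c * s)"
      by (simp add: field_simps)
    ultimately show ?thesis using cs(3) by (simp add: field_simps)
  qed
  define h where "h = r/2"
  have rh: "r = 2 * h" by (simp add: h_def)
  have rw: "1/2 * (c + s) \<le> h * (c + s)" unfolding h_def using r w by (intro mult_right_mono) auto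
  have K: "2 * c + 7/4 * s \<le> k" "k \<le> 3 * c + 2273/1000 * s - 2 * h"
    and M: "7/4 * c - 3 * s \<le> m" "m \<le> 2273/1000 * c - 2 * s - 2 * h" using raised top unfolding rh by simp_all
  note P = mult_right_mono[OF K(1) cs(1)] mult_right_mono[OF K(1) cs(2)] mult_right_mono[OF K(2) cs(1)] mult_right_mono[OF K(2) cs(2)]
    mult_right_mono[OF M(1) cs(1)] mult_right_mono[OF M(1) cs(2)] mult_right_mono[OF M(2) cs(1)] mult_right_mono[OF M(2) cs(2)]
  have xy: "x = k * c - m * s + h * c - h * s" "y = k * s + m * c + h * s + h * c"
    by (simp_all add: x_def y_def cenx_def ceny_def rh algebra_simps)
  have "2 * (c * c + s * s) - 523/1000 * (c * s) + h * (c + s) \<le> x" unfolding xy using P by (simp add: algebra_simps)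
  moreover have "x \<le> 3 * (c * c + s * s) + 523/1000 * (c * s) - h * (c + s)" unfolding xy using P by (simp add: algebra_simps)
  moreover have "7/4 * (c * c + s * s) - c * s + h * (c + s) \<le> y" unfolding xy using P by (simp add: algebra_simps)
  moreover have "y \<le> 2273/1000 * (c * c + s * s) + c * s - h * (c + s)"
    using P(4,7) unfolding xy by (simp only: ring_distribs left_diff_distrib right_diff_distrib mult.assoc) (simp add: mult.commute mult.left_commute)
  ultimately have "244/100 \<le> x" "x \<le> 256/100" "195/100 \<le> y" "y \<le> 207/100" using sc rw w unfolding cs(3) by argo+
  moreover have "(a, b) \<in> B" if "(a - x) * (a - x) + (b - y) * (b - y) \<le> 1/4" for a b
    unfolding B by (rule near_centre[OF cs(3) r]) (use that in \<open>simp add: x_def y_def\<close>)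
  ultimately show ?thesis by blast
qed

text \<open>Only the upper right side could cut off \<open>(5/2, 5/2)\<close>. In that case missing
  \<open>(5/2, 1861/1000)\<close> forces \<open>s < c\<close> and missing
  \<open>(1861/1000, 5/2)\<close> forces \<open>c < s\<close>.\<close>

lemma box_c2C2:
  assumes "is_box r B" and i: "(2, 2273/1000) \<in> B" "(2, 2727/1000) \<in> B" "(2273/1000, 2) \<in> B" "(2727/1000, 2) \<in> B"
    and n: "(5/2, 1861/1000) \<notin> B" "(1861/1000, 5/2) \<notin> B"
  shows "(5/2, 5/2) \<in> B"
proof (rule ccontr)
  assume o: "\<not> ?thesis"
  obtain c s k m where f: "fitting r c s k m" and B: "\<And>a b. (a, b) \<in> B \<longleftrightarrow> inb r c s k m a b"
    using is_boxE[OF assms(1)] by blast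
  have cs: "0 \<le> c" "0 \<le> s" "c * c + s * s = 1" and r: "1 < r" using f by (auto simp: fitting_def)
  note w = trig_pair[OF cs]
  note i = i[unfolded B inb_def] and o = o[unfolded B inb_def] and n = n[unfolded B inb_def]
  have "5/2 * c + 5/2 * s \<le> k \<or> k + r \<le> 5/2 * c + 5/2 * s \<or> 5/2 * c - 5/2 * s \<le> m \<or> m + r \<le> 5/2 * c - 5/2 * s" using o by linarith
  then have "k + r \<le> 5/2 * c + 5/2 * s" using i cs(1,2) w by linarith
  then show False using i n r w cs(1,2) by linarith
qed

section \<open>Labelled configurations and their symmetries\<close>

definition reflx :: "real \<times> real \<Rightarrow> real \<times> real" where "reflx p = (5 - fst p, snd p)"

lemma reflx_reflx [simp]: "reflx (reflx p) = p" by (simp add: reflx_def)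

lemma inj_reflx: "inj reflx" by (metis injI reflx_reflx)

lemma mem_swap_image: "(a, b) \<in> prod.swap ` B \<longleftrightarrow> (b, a) \<in> B"
  by force

lemma mem_reflx_image: "(a, b) \<in> reflx ` B \<longleftrightarrow> (5 - a, b) \<in> B"
  by (force simp: image_iff reflx_def)

lemma is_box_swap:
  assumes "is_box r B"
  shows "is_box r (prod.swap ` B)"
proof -
  obtain c s k m where f: "fitting r c s k m" and B: "\<And>a b. (a, b) \<in> B \<longleftrightarrow> inb r c s k m a b"
    using is_boxE[OF assms] by blast
  have "prod.swap ` B = {(a, b). inb r s c k (- m - r) a b}"
    by (auto simp: mem_swap_image B inb_swap)
  then show ?thesis unfolding is_box_def using fitting_swap[OF f] by blast
qed

lemma is_box_reflx:
  assumes "is_box r B"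
  shows "is_box r (reflx ` B)"
proof -
  obtain c s k m where f: "fitting r c s k m" and B: "\<And>a b. (a, b) \<in> B \<longleftrightarrow> inb r c s k m a b"
    using is_boxE[OF assms] by blast
  have "(a, b) \<in> reflx ` B \<longleftrightarrow> inb r s c (5 * s + m) (k - 5 * c) a b" for a b
    unfolding mem_reflx_image B using inb_reflx[of r s c m k "5 - a" b] by simp
  then have "reflx ` B = {(a, b). inb r s c (5 * s + m) (k - 5 * c) a b}" by auto
  then show ?thesis unfolding is_box_def using fitting_reflx[OF f] by blast
qed

lemma disjoint_boxes_image:
  assumes "disjoint_boxes r I" "inj f" "\<And>B. is_box r B \<Longrightarrow> is_box r (f ` B)"
  shows "disjoint_boxes r ((`) f ` I)"
proof -
  have "inj_on ((`) f) I" using assms(2) by (simp add: inj_on_def inj_image_eq_iff)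
  then have "card ((`) f ` I) = 22" using assms(1) by (simp add: card_image disjoint_boxes_def)
  moreover have "B \<inter> C = {}" if *: "B \<in> (`) f ` I" "C \<in> (`) f ` I" "B \<noteq> C" for B C
  proof -
    obtain B' C' where e: "B = f ` B'" "C = f ` C'" "B' \<in> I" "C' \<in> I" using *(1,2) by blast
    then have "B' \<inter> C' = {}" using e *(3) assms(1) unfolding disjoint_boxes_def by blast
    then show ?thesis unfolding e(1,2) using assms(2) by (simp flip: image_Int)
  qed
  moreover have "is_box r B" if "B \<in> (`) f ` I" for B using that assms(1,3) unfolding disjoint_boxes_def by blast
  ultimately show ?thesis using assms(1) unfolding disjoint_boxes_def by simp
qed

text \<open>\<open>F\<close> labels the boxes by the points of the rows, \<open>G\<close> by the mirrored points, which form columns.\<close>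

definition cfg :: "real \<Rightarrow> (real \<times> real) set set \<Rightarrow> (nat \<times> nat \<Rightarrow> (real \<times> real) set) \<Rightarrow> (nat \<times> nat \<Rightarrow> (real \<times> real) set) \<Rightarrow> bool" where
  "cfg r I F G \<longleftrightarrow> disjoint_boxes r I \<and> bij_betw F Idx I \<and> bij_betw G Idx I \<and>
     (\<forall>i\<in>Idx. \<forall>t u. 541/1000 \<le> t \<longrightarrow> t \<le> 995/1000 \<longrightarrow> 0 \<le> u \<longrightarrow> u \<le> 4/10 \<longrightarrow> pt t u i \<in> F i \<and> prod.swap (pt t u i) \<in> G i)"

lemma bij_betw_image:
  assumes f: "inj f" and F: "bij_betw F A I"
  shows "bij_betw (\<lambda>i. f ` F i) A ((`) f ` I)"
proof -
  have "inj_on ((`) f) I" using f by (simp add: inj_on_def inj_image_eq_iff)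
  then have "bij_betw ((`) f) I ((`) f ` I)" by (simp add: bij_betw_def)
  from bij_betw_trans[OF F this] show ?thesis by (simp add: comp_def)
qed

lemma exists_cfg:
  assumes I: "disjoint_boxes r I"
  shows "\<exists>F G. cfg r I F G"
proof -
  obtain F where F: "tracked I F (995/1000)" using tracked_995[OF I] by blast
  obtain G where G: "tracked ((`) prod.swap ` I) G (995/1000)"
    using tracked_995[OF disjoint_boxes_image[OF I inj_swap is_box_swap]] by blast
  have e: "(`) prod.swap ` (`) prod.swap ` I = I" by (simp add: image_comp comp_def)
  have "bij_betw (\<lambda>i. prod.swap ` G i) Idx I"
    using bij_betw_image[OF inj_swap, of G Idx "(`) prod.swap ` I"] G unfolding e by (simp add: tracked_def)
  then have "cfg r I F (\<lambda>i. prod.swap ` G i)"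
    using I F G unfolding cfg_def tracked_def by simp
  then show ?thesis by blast
qed

lemma cfg_swap:
  assumes "cfg r I F G"
  shows "cfg r ((`) prod.swap ` I) (\<lambda>i. prod.swap ` G i) (\<lambda>i. prod.swap ` F i)"
  using assms unfolding cfg_def
  by (auto intro!: bij_betw_image disjoint_boxes_image inj_swap is_box_swap simp: mem_swap_image)
    (metis image_eqI swap_swap)

definition flop :: "nat \<times> nat \<Rightarrow> nat \<times> nat" where "flop = (\<lambda>(i, j). (i, 3 + i mod 2 - j))"

lemma flop_flop: "i \<in> Idx \<Longrightarrow> flop (flop i) = i" by (auto simp: Idx_def flop_def)
lemma flop_Idx: "i \<in> Idx \<Longrightarrow> flop i \<in> Idx" by (auto simp: Idx_def flop_def)
lemma flip_flip: "i \<in> Idx \<Longrightarrow> flip (flip i) = i" by (auto simp: Idx_def flip_def)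

lemma pt_flop:
  assumes "i \<in> Idx"
  shows "pt t u (flop i) = reflx (pt t u i)"
proof -
  obtain a b where i: "i = (a, b)" "a < 5" "b < 4 + a mod 2" using assms by (auto simp: Idx_def)
  show ?thesis
  proof (cases "even a")
    case True
    then have "a mod 2 = 0" by presburger
    then show ?thesis using i True by (auto simp: pt_def flop_def reflx_def of_nat_diff)
  next
    case False
    then have m: "a mod 2 = Suc 0" by presburger
    then have "b = 0 \<or> b = 1 \<or> b = 2 \<or> b = 3 \<or> b = 4" using i by linarith
    then show ?thesis using i False m by (auto simp: pt_def flop_def reflx_def)
  qed
qed

lemma bij_betw_involution:
  assumes "bij_betw F A I" "\<And>i. i \<in> A \<Longrightarrow> g i \<in> A" "\<And>i. i \<in> A \<Longrightarrow> g (g i) = i"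
  shows "bij_betw (\<lambda>i. F (g i)) A I"
proof -
  have "bij_betw g A A" by (rule bij_betw_byWitness[of _ g]) (use assms in auto)
  from bij_betw_trans[OF this assms(1)] show ?thesis by (simp add: comp_def)
qed

text \<open>The reflection reverses every row but permutes the columns, turning their offset
  \<open>t\<close> into \<open>1536/1000 - t\<close>; hence \<open>flop\<close> on row labels and
  \<open>flip\<close> on column labels. The interval from \<open>541/1000\<close> to
  \<open>995/1000\<close> is symmetric about \<open>768/1000\<close> and so preserved.\<close>

lemma cfg_reflx:
  assumes c: "cfg r I F G"
  shows "cfg r ((`) reflx ` I) (\<lambda>i. reflx ` F (flop i)) (\<lambda>i. reflx ` G (flip i))"
proof -
  have I: "disjoint_boxes r I" "bij_betw F Idx I" "bij_betw G Idx I"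
    and p: "\<And>i t u. i \<in> Idx \<Longrightarrow> 541/1000 \<le> t \<Longrightarrow> t \<le> 995/1000 \<Longrightarrow> 0 \<le> u \<Longrightarrow> u \<le> 4/10 \<Longrightarrow> pt t u i \<in> F i \<and> prod.swap (pt t u i) \<in> G i"
    using c by (auto simp: cfg_def)
  have "pt t u i \<in> reflx ` F (flop i)" if "i \<in> Idx" "541/1000 \<le> t" "t \<le> 995/1000" "0 \<le> u" "u \<le> 4/10" for i t u
    using p[OF flop_Idx[OF that(1)] that(2-5)] pt_flop[OF that(1), of t u] by (metis image_eqI reflx_reflx)
  moreover have "prod.swap (pt t u i) \<in> reflx ` G (flip i)" if i: "i \<in> Idx" and t: "541/1000 \<le> t" "t \<le> 995/1000" "0 \<le> u" "u \<le> 4/10" for i t u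
  proof -
    have "prod.swap (pt (1536/1000 - t) u (flip i)) \<in> G (flip i)" using p[OF flip_Idx[OF i]] t by simp
    moreover have "prod.swap (pt t u i) = reflx (prod.swap (pt (1536/1000 - t) u (flip i)))"
      unfolding pt_flip[OF i] by (cases "pt t u i") (simp add: reflx_def)
    ultimately show ?thesis by blast
  qed
  ultimately show ?thesis unfolding cfg_def
    using disjoint_boxes_image[OF I(1) inj_reflx is_box_reflx] bij_betw_image[OF inj_reflx bij_betw_involution[OF I(2) flop_Idx flop_flop]]
      bij_betw_image[OF inj_reflx bij_betw_involution[OF I(3) flip_Idx flip_flip]] by blast
qed

lemma cfg_row:
  assumes "cfg r I F G" "pt t u i = p" "i \<in> Idx" "541/1000 \<le> t" "t \<le> 995/1000" "0 \<le> u" "u \<le> 4/10"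
  shows "p \<in> F i"
  using assms unfolding cfg_def by blast

lemma cfg_column:
  assumes "cfg r I F G" "pt t u i = (b, a)" "i \<in> Idx" "541/1000 \<le> t" "t \<le> 995/1000" "0 \<le> u" "u \<le> 4/10"
  shows "(a, b) \<in> G i"
proof -
  have "prod.swap (pt t u i) \<in> G i" using assms(1,3-) unfolding cfg_def by blast
  then show ?thesis by (simp add: assms(2))
qed

lemma cfg_inj:
  assumes "cfg r I F G" "i \<in> Idx" "j \<in> Idx"
  shows "F i = F j \<longleftrightarrow> i = j" "G i = G j \<longleftrightarrow> i = j"
  using assms by (auto simp: cfg_def bij_betw_def inj_on_def)

lemma cfg_in_I:
  assumes "cfg r I F G" "i \<in> Idx"
  shows "F i \<in> I" "G i \<in> I"
  using assms by (auto simp: cfg_def bij_betw_def)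

lemma cfg_box:
  assumes "cfg r I F G" "i \<in> Idx"
  shows "is_box r (F i)" "is_box r (G i)"
  using cfg_in_I[OF assms] assms(1) by (simp_all add: cfg_def disjoint_boxes_def)

lemma cfg_disjoint:
  assumes "cfg r I F G" "B \<in> I" "C \<in> I" "p \<in> B" "p \<in> C"
  shows "B = C"
  using assms unfolding cfg_def disjoint_boxes_def by blast

lemma cfg_surj:
  assumes "cfg r I F G" "i \<in> Idx"
  shows "\<exists>j\<in>Idx. F i = G j"
  using assms by (auto simp: cfg_def bij_betw_def image_iff set_eq_iff)

text \<open>\<open>t\<close> and \<open>t'\<close> range over the two ends of the admissible interval, where the points of a row and of a
  column are as far apart as possible.\<close>

definition near :: "nat \<times> nat \<Rightarrow> nat \<times> nat \<Rightarrow> bool" where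
  "near i j \<longleftrightarrow> (\<forall>t\<in>{541/1000, 995/1000}. \<forall>t'\<in>{541/1000, 995/1000}.
     (fst (pt t 0 i) - snd (pt t' 0 j)) * (fst (pt t 0 i) - snd (pt t' 0 j)) +
     (snd (pt t 0 i) - fst (pt t' 0 j)) * (snd (pt t 0 i) - fst (pt t' 0 j)) < 21/10)"

lemma cfg_near:
  assumes c: "cfg r I F G" and ij: "i \<in> Idx" "j \<in> Idx" and e: "F i = G j"
  shows "near i j"
  unfolding near_def
proof (intro ballI)
  fix t t' :: real
  assume t: "t \<in> {541/1000, 995/1000}" and t': "t' \<in> {541/1000, 995/1000}"
  have "(fst (pt t 0 i), snd (pt t 0 i)) \<in> F i" by (rule cfg_row[OF c _ ij(1), of t 0]) (use t in auto)
  moreover have "(snd (pt t' 0 j), fst (pt t' 0 j)) \<in> F i"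
    unfolding e by (rule cfg_column[OF c _ ij(2), of t' 0]) (use t' in auto)
  ultimately show "(fst (pt t 0 i) - snd (pt t' 0 j)) * (fst (pt t 0 i) - snd (pt t' 0 j)) +
     (snd (pt t 0 i) - fst (pt t' 0 j)) * (snd (pt t 0 i) - fst (pt t' 0 j)) < 21/10"
    by (rule box_diameter[OF cfg_box(1)[OF c ij(1)]])
qed

text \<open>A numerical check over all 22 labels. Positions not listed are reached through
  \<open>cfg_swap\<close> and \<open>cfg_reflx\<close>.\<close>

lemma near_cases:
  "j \<in> Idx \<Longrightarrow> near (0, 0) j \<Longrightarrow> j = (0, 0) \<or> j = (1, 0) \<or> j = (1, 1)"
  "j \<in> Idx \<Longrightarrow> near (0, 1) j \<Longrightarrow> j = (1, 0) \<or> j = (1, 1) \<or> j = (2, 0)"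
  "j \<in> Idx \<Longrightarrow> near (0, 2) j \<Longrightarrow> j = (2, 0) \<or> j = (3, 0) \<or> j = (3, 1)"
  "j \<in> Idx \<Longrightarrow> near (0, 3) j \<Longrightarrow> j = (3, 0) \<or> j = (3, 1) \<or> j = (4, 0)"
  "j \<in> Idx \<Longrightarrow> near (1, 0) j \<Longrightarrow> j = (0, 0) \<or> j = (0, 1) \<or> j = (1, 1)"
  "j \<in> Idx \<Longrightarrow> near (1, 2) j \<Longrightarrow> j = (1, 1) \<or> j = (2, 0) \<or> j = (2, 1) \<or> j = (3, 1)"
  "j \<in> Idx \<Longrightarrow> near (1, 4) j \<Longrightarrow> j = (3, 1) \<or> j = (4, 0) \<or> j = (4, 1)"
  "j \<in> Idx \<Longrightarrow> near (2, 0) j \<Longrightarrow> j = (0, 1) \<or> j = (0, 2) \<or> j = (1, 2)"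
  "j \<in> Idx \<Longrightarrow> near (3, 0) j \<Longrightarrow> j = (0, 2) \<or> j = (0, 3) \<or> j = (1, 3)"
  "j \<in> Idx \<Longrightarrow> near (2, 1) j \<Longrightarrow> j = (1, 1) \<or> j = (1, 2) \<or> j = (1, 3) \<or> j = (2, 1) \<or> j = (2, 2)"
  "j \<in> Idx \<Longrightarrow> near (2, 2) j \<Longrightarrow> j = (2, 1) \<or> j = (2, 2) \<or> j = (3, 1) \<or> j = (3, 2) \<or> j = (3, 3)"
  unfolding Idx_eq near_def pt_def by (elim insertE emptyE; simp)+

lemma cfg_candidates:
  assumes c: "cfg r I F G"
  shows "F (0, 0) \<in> {G (0, 0), G (1, 0), G (1, 1)}"
    "F (0, 1) \<in> {G (1, 0), G (1, 1), G (2, 0)}"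
    "F (0, 2) \<in> {G (2, 0), G (3, 0), G (3, 1)}"
    "F (0, 3) \<in> {G (3, 0), G (3, 1), G (4, 0)}"
    "F (1, 0) \<in> {G (0, 0), G (0, 1), G (1, 1)}"
    "F (1, 2) \<in> {G (1, 1), G (2, 0), G (2, 1), G (3, 1)}"
    "F (1, 4) \<in> {G (3, 1), G (4, 0), G (4, 1)}"
    "F (2, 0) \<in> {G (0, 1), G (0, 2), G (1, 2)}"
    "F (3, 0) \<in> {G (0, 2), G (0, 3), G (1, 3)}"
    "F (2, 1) \<in> {G (1, 1), G (1, 2), G (1, 3), G (2, 1), G (2, 2)}"
    "F (2, 2) \<in> {G (2, 1), G (2, 2), G (3, 1), G (3, 2), G (3, 3)}"
proof -
  have "\<exists>j\<in>Idx. near i j \<and> F i = G j" if "i \<in> Idx" for i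
    using cfg_surj[OF c that] cfg_near[OF c that] by blast
  note * = this near_cases
  note E = bexE[OF *(1)]
  show "F (0, 0) \<in> {G (0, 0), G (1, 0), G (1, 1)}" by (rule E[of "(0, 0)"]) (simp add: Idx_def, use near_cases(1) in blast)
  show "F (0, 1) \<in> {G (1, 0), G (1, 1), G (2, 0)}" by (rule E[of "(0, 1)"]) (simp add: Idx_def, use near_cases(2) in blast)
  show "F (0, 2) \<in> {G (2, 0), G (3, 0), G (3, 1)}" by (rule E[of "(0, 2)"]) (simp add: Idx_def, use near_cases(3) in blast)
  show "F (0, 3) \<in> {G (3, 0), G (3, 1), G (4, 0)}" by (rule E[of "(0, 3)"]) (simp add: Idx_def, use near_cases(4) in blast)
  show "F (1, 0) \<in> {G (0, 0), G (0, 1), G (1, 1)}" by (rule E[of "(1, 0)"]) (simp add: Idx_def, use near_cases(5) in blast)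
  show "F (1, 2) \<in> {G (1, 1), G (2, 0), G (2, 1), G (3, 1)}" by (rule E[of "(1, 2)"]) (simp add: Idx_def, use near_cases(6) in blast)
  show "F (1, 4) \<in> {G (3, 1), G (4, 0), G (4, 1)}" by (rule E[of "(1, 4)"]) (simp add: Idx_def, use near_cases(7) in blast)
  show "F (2, 0) \<in> {G (0, 1), G (0, 2), G (1, 2)}" by (rule E[of "(2, 0)"]) (simp add: Idx_def, use near_cases(8) in blast)
  show "F (3, 0) \<in> {G (0, 2), G (0, 3), G (1, 3)}" by (rule E[of "(3, 0)"]) (simp add: Idx_def, use near_cases(9) in blast)
  show "F (2, 1) \<in> {G (1, 1), G (1, 2), G (1, 3), G (2, 1), G (2, 2)}" by (rule E[of "(2, 1)"]) (simp add: Idx_def, use near_cases(10) in blast)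
  show "F (2, 2) \<in> {G (2, 1), G (2, 2), G (3, 1), G (3, 2), G (3, 3)}" by (rule E[of "(2, 2)"]) (simp add: Idx_def, use near_cases(11) in blast)
qed

lemma reflx_image_eq: "reflx ` A = reflx ` B \<longleftrightarrow> A = B"
  by (rule inj_image_eq_iff[OF inj_reflx])

lemma swap_image_eq: "prod.swap ` A = prod.swap ` B \<longleftrightarrow> A = B"
  by (rule inj_image_eq_iff[OF inj_swap])

text \<open>The paths cross: \<open>634/1000 + 866/1000 = 3/2\<close>, so at this \<open>t\<close>
  the second point of the second row and that of the second column are both at
  \<open>(3/2, 3/2)\<close>. Symmetry gives the other three.\<close>

lemma cfg_common:
  assumes c: "cfg r I F G"
  shows "F (1, 1) = G (1, 1)" "F (1, 3) = G (3, 1)" "F (3, 1) = G (1, 3)" "F (3, 3) = G (3, 3)"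
proof -
  have 1: "F (1, 1) = G (1, 1)" if c: "cfg r I F G" for I F G
  proof (rule cfg_disjoint[OF c])
    show "F (1, 1) \<in> I" "G (1, 1) \<in> I" using cfg_in_I[OF c] by (simp_all add: Idx_def)
    show "(3/2, 3/2) \<in> F (1, 1)" by (rule cfg_row[OF c, of "634/1000" 0]) (simp_all add: Idx_def pt_def)
    show "(3/2, 3/2) \<in> G (1, 1)" by (rule cfg_column[OF c, of "634/1000" 0]) (simp_all add: Idx_def pt_def)
  qed
  have 2: "F (1, 3) = G (3, 1)" if c: "cfg r I F G" for I F G
    using 1[OF cfg_reflx[OF c]] by (simp add: reflx_image_eq flop_def flip_def)
  have 3: "F (3, 1) = G (1, 3)" if c: "cfg r I F G" for I F G
    using 2[OF cfg_swap[OF c]] by (simp add: swap_image_eq)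
  show "F (1, 1) = G (1, 1)" "F (1, 3) = G (3, 1)" "F (3, 1) = G (1, 3)" using 1[OF c] 2[OF c] 3[OF c] .
  show "F (3, 3) = G (3, 3)" using 3[OF cfg_reflx[OF c]] by (simp add: reflx_image_eq flop_def flip_def)
qed

section \<open>Excluding the crosswise corner\<close>

lemma row_b1A1:
  assumes c: "cfg r I F G" and e: "F (1, 0) = G (0, 0)"
  shows "(1, 7/4) \<in> F (1, 0)"
proof (rule box_b1A1)
  show "is_box r (F (1, 0))" using cfg_box[OF c] by (simp add: Idx_def)
  show "(1/2, 1861/1000) \<in> F (1, 0)" by (rule cfg_row[OF c, of "995/1000" 0]) (simp_all add: Idx_def pt_def)
  show "(9/10, 1861/1000) \<in> F (1, 0)" by (rule cfg_row[OF c, of "995/1000" "4/10"]) (simp_all add: Idx_def pt_def)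
  \<comment> \<open>\<open>884/1000\<close> puts the second row at height \<open>7/4\<close>, and
    \<open>u = 4/10\<close> moves its first point in to \<open>9/10\<close>.\<close>
  show "(9/10, 7/4) \<in> F (1, 0)" by (rule cfg_row[OF c, of "884/1000" "4/10"]) (simp_all add: Idx_def pt_def)
  show "(541/1000, 1) \<in> F (1, 0)" unfolding e by (rule cfg_column[OF c, of "541/1000" 0]) (simp_all add: Idx_def pt_def)
  show "(995/1000, 1) \<in> F (1, 0)" unfolding e by (rule cfg_column[OF c, of "995/1000" 0]) (simp_all add: Idx_def pt_def)
qed

lemma row_b1A2:
  assumes c: "cfg r I F G" and e: "F (1, 0) = G (0, 1)"
  shows "(1, 7/4) \<in> F (1, 0)"
proof (rule box_b1A2)
  show "is_box r (F (1, 0))" using cfg_box[OF c] by (simp add: Idx_def)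
  show "(1/2, 1407/1000) \<in> F (1, 0)" by (rule cfg_row[OF c, of "541/1000" 0]) (simp_all add: Idx_def pt_def)
  show "(9/10, 1407/1000) \<in> F (1, 0)" by (rule cfg_row[OF c, of "541/1000" "4/10"]) (simp_all add: Idx_def pt_def)
  show "(9/10, 7/4) \<in> F (1, 0)" by (rule cfg_row[OF c, of "884/1000" "4/10"]) (simp_all add: Idx_def pt_def)
  show "(541/1000, 2) \<in> F (1, 0)" unfolding e by (rule cfg_column[OF c, of "541/1000" 0]) (simp_all add: Idx_def pt_def)
  show "(995/1000, 2) \<in> F (1, 0)" unfolding e by (rule cfg_column[OF c, of "995/1000" 0]) (simp_all add: Idx_def pt_def)
qed

lemma row_b2B2:
  assumes c: "cfg r I F G" and b: "(1, 7/4) \<in> F (1, 0)" and n: "G (1, 0) \<noteq> F (1, 1)"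
  shows "(2, 7/4) \<in> F (1, 1)"
proof -
  have i: "(1, 0) \<in> Idx" "(1, 1) \<in> Idx" by (simp_all add: Idx_def)
  have "(1, 7/4) \<in> F (1, 1) \<or> (2, 7/4) \<in> F (1, 1)"
  proof (rule box_b2B2)
    show "is_box r (F (1, 1))" using cfg_box[OF c] i by simp
    show "(3/2, 7/4) \<in> F (1, 1)" by (rule cfg_row[OF c, of "884/1000" 0]) (simp_all add: Idx_def pt_def)
    show "(3/2, 1861/1000) \<in> F (1, 1)" by (rule cfg_row[OF c, of "995/1000" 0]) (simp_all add: Idx_def pt_def)
    show "(1407/1000, 3/2) \<in> F (1, 1)" unfolding cfg_common(1)[OF c]
      by (rule cfg_column[OF c, of "541/1000" 0]) (simp_all add: Idx_def pt_def)
    show "(1861/1000, 3/2) \<in> F (1, 1)" unfolding cfg_common(1)[OF c]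
      by (rule cfg_column[OF c, of "995/1000" 0]) (simp_all add: Idx_def pt_def)
    have "(3/2, 9/10) \<in> G (1, 0)" by (rule cfg_column[OF c, of "634/1000" "4/10"]) (simp_all add: Idx_def pt_def)
    then show "(3/2, 9/10) \<notin> F (1, 1)" using cfg_disjoint[OF c] cfg_in_I[OF c] i n by blast
  qed
  moreover have "(1, 7/4) \<notin> F (1, 1)"
  proof
    assume "(1, 7/4) \<in> F (1, 1)"
    then have "F (1, 0) = F (1, 1)" using cfg_disjoint[OF c] cfg_in_I[OF c] i b by blast
    then show False using cfg_inj[OF c i] by simp
  qed
  ultimately show ?thesis by blast
qed

text \<open>The crosswise corner starts a chain reaction: in the bottom row each box has to take the
  next column, since the other candidates are taken, and so on up to
  \<open>F (1, 4) = G (4, 1)\<close>. From both ends the second row is then pushed inwards, so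
  \<open>F (1, 1)\<close> and \<open>F (1, 3)\<close> occupy the points at height \<open>7/4\<close>
  beside \<open>F (1, 2)\<close> and lift this box.\<close>

lemma swirl_row:
  assumes c: "cfg r I F G" and e: "F (0, 0) = G (1, 0)" "F (1, 0) = G (0, 0)"
  shows "F (1, 2) = G (2, 1)"
    "\<exists>x y. 244/100 \<le> x \<and> x \<le> 256/100 \<and> 195/100 \<le> y \<and> y \<le> 207/100 \<and>
      (\<forall>a b. (a - x) * (a - x) + (b - y) * (b - y) \<le> 1/4 \<longrightarrow> (a, b) \<in> F (1, 2))"
proof -
  note inj = cfg_inj[OF c] and d = cfg_disjoint[OF c] and I = cfg_in_I[OF c] and m = cfg_common[OF c]
  have i: "(0, 0) \<in> Idx" "(0, 1) \<in> Idx" "(0, 2) \<in> Idx" "(0, 3) \<in> Idx" "(1, 0) \<in> Idx" "(1, 1) \<in> Idx" "(1, 2) \<in> Idx"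
    "(1, 3) \<in> Idx" "(1, 4) \<in> Idx" "(2, 0) \<in> Idx" "(2, 1) \<in> Idx" "(2, 2) \<in> Idx" by (simp_all add: Idx_def)
  have a1: "F (0, 1) = G (2, 0)" using cfg_candidates(2)[OF c] inj i unfolding e(1)[symmetric] m[symmetric] by auto
  have a2: "F (0, 2) = G (3, 0)" using cfg_candidates(3)[OF c] inj i unfolding a1[symmetric] m[symmetric] by auto
  have a3: "F (0, 3) = G (4, 0)" using cfg_candidates(4)[OF c] inj i unfolding a2[symmetric] m[symmetric] by auto
  have a4: "F (1, 4) = G (4, 1)" using cfg_candidates(7)[OF c] inj i unfolding a3[symmetric] m[symmetric] by simp
  show b3: "F (1, 2) = G (2, 1)" using cfg_candidates(6)[OF c] inj i unfolding a1[symmetric] m[symmetric] by auto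
  have l: "(2, 7/4) \<in> F (1, 1)" by (rule row_b2B2[OF c row_b1A1[OF c e(2)]]) (use e(1) inj i in auto)
  note c' = cfg_reflx[OF c]
  \<comment> \<open>Seen from the right, the end box of the row is b1A2 rather than b1A1, because
    \<open>F (1, 4) = G (4, 1)\<close>.\<close>
  have "(1, 7/4) \<in> reflx ` F (flop (1, 0))"
    by (rule row_b1A2[OF c']) (use a4 in \<open>simp add: flop_def flip_def reflx_image_eq\<close>)
  moreover have "reflx ` G (flip (1, 0)) \<noteq> reflx ` F (flop (1, 1))"
    using inj i unfolding reflx_image_eq by (simp add: flop_def flip_def flip: a2)
  ultimately have "(2, 7/4) \<in> reflx ` F (flop (1, 1))" by (rule row_b2B2[OF c'])
  then have r: "(3, 7/4) \<in> F (1, 3)" by (simp add: mem_reflx_image flop_def)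
  have n: "p \<notin> F (1, 2)" if "p \<in> F j" "j \<in> Idx" "j \<noteq> (1, 2)" for p j
    using d[of "F j" "F (1, 2)" p] I inj that i by auto
  show "\<exists>x y. 244/100 \<le> x \<and> x \<le> 256/100 \<and> 195/100 \<le> y \<and> y \<le> 207/100 \<and>
      (\<forall>a b. (a - x) * (a - x) + (b - y) * (b - y) \<le> 1/4 \<longrightarrow> (a, b) \<in> F (1, 2))"
  proof (rule box_b3C2)
    show "is_box r (F (1, 2))" using cfg_box[OF c] i by simp
    show "(5/2, 1407/1000) \<in> F (1, 2)" by (rule cfg_row[OF c, of "541/1000" 0]) (simp_all add: Idx_def pt_def)
    show "(5/2, 7/4) \<in> F (1, 2)" by (rule cfg_row[OF c, of "884/1000" 0]) (simp_all add: Idx_def pt_def)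
    show "(5/2, 1861/1000) \<in> F (1, 2)" by (rule cfg_row[OF c, of "995/1000" 0]) (simp_all add: Idx_def pt_def)
    show "(2273/1000, 2) \<in> F (1, 2)" unfolding b3 by (rule cfg_column[OF c, of "541/1000" 0]) (simp_all add: Idx_def pt_def)
    show "(2727/1000, 2) \<in> F (1, 2)" unfolding b3 by (rule cfg_column[OF c, of "995/1000" 0]) (simp_all add: Idx_def pt_def)
    have "(5/2, 1) \<in> F (0, 1)" unfolding a1 by (rule cfg_column[OF c, of "768/1000" 0]) (simp_all add: Idx_def pt_def)
    then show "(5/2, 1) \<notin> F (1, 2)" using n i by simp
    have "(2, 2273/1000) \<in> F (2, 1)" by (rule cfg_row[OF c, of "541/1000" 0]) (simp_all add: Idx_def pt_def)
    then show "(2, 2273/1000) \<notin> F (1, 2)" using n i by simp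
    have "(3, 2273/1000) \<in> F (2, 2)" by (rule cfg_row[OF c, of "541/1000" 0]) (simp_all add: Idx_def pt_def)
    then show "(3, 2273/1000) \<notin> F (1, 2)" using n i by simp
    show "(2, 7/4) \<notin> F (1, 2)" "(3, 7/4) \<notin> F (1, 2)" using n l r i by simp_all
  qed
qed

text \<open>The boxes b3C2 and c2B3 contain discs of radius 1/2 whose centres have distance less than 1.\<close>

lemma no_swirl:
  assumes c: "cfg r I F G" and e: "F (0, 0) = G (1, 0)" "F (1, 0) = G (0, 0)"
  shows False
proof -
  have i: "(1, 2) \<in> Idx" "(2, 1) \<in> Idx" by (simp_all add: Idx_def)
  obtain x y where xy: "244/100 \<le> x" "x \<le> 256/100" "195/100 \<le> y" "y \<le> 207/100"
    and B: "\<And>a b. (a - x) * (a - x) + (b - y) * (b - y) \<le> 1/4 \<Longrightarrow> (a, b) \<in> F (1, 2)"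
    using swirl_row(2)[OF c e] by blast
  have "prod.swap ` G (0, 0) = prod.swap ` F (1, 0)" "prod.swap ` G (1, 0) = prod.swap ` F (0, 0)" using e by simp_all
  from swirl_row(2)[OF cfg_swap[OF c] this]
  obtain x' y' where xy': "244/100 \<le> x'" "x' \<le> 256/100" "195/100 \<le> y'" "y' \<le> 207/100"
    and C: "\<And>a b. (a - x') * (a - x') + (b - y') * (b - y') \<le> 1/4 \<Longrightarrow> (b, a) \<in> G (1, 2)"
    unfolding mem_swap_image by blast
  have sq: "z * z \<le> 1/8" if "\<bar>z\<bar> \<le> 31/100" for z :: real
    using mult_mono[OF that that] by simp
  define p q where "p = (x + y') / 2" and "q = (y + x') / 2"
  have "\<bar>p - x\<bar> \<le> 31/100" "\<bar>q - y\<bar> \<le> 31/100" "\<bar>p - y'\<bar> \<le> 31/100" "\<bar>q - x'\<bar> \<le> 31/100"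
    using xy xy' unfolding p_def q_def by (simp_all add: abs_le_iff field_simps)
  note this[THEN sq]
  then have "(p, q) \<in> F (1, 2)" "(p, q) \<in> G (1, 2)" using B[of p q] C[of q p] by simp_all
  then have "F (1, 2) = G (1, 2)" using cfg_disjoint[OF c] cfg_in_I[OF c] i by blast
  then show False using swirl_row(1)[OF c e] cfg_inj(2)[OF c i] by simp
qed

lemma cfg_corner:
  assumes c: "cfg r I F G"
  shows "F (0, 0) = G (0, 0)"
proof (rule ccontr)
  assume n: "F (0, 0) \<noteq> G (0, 0)"
  have i: "(0, 0) \<in> Idx" "(1, 1) \<in> Idx" by (simp_all add: Idx_def)
  note inj = cfg_inj[OF c i] and m = cfg_common(1)[OF c]
  have "F (0, 0) = G (1, 0)" using cfg_candidates(1)[OF c] n inj m by auto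
  moreover have "G (0, 0) \<in> {F (0, 0), F (1, 0), F (1, 1)}"
    using cfg_candidates(1)[OF cfg_swap[OF c]] by (simp add: swap_image_eq)
  then have "F (1, 0) = G (0, 0)" using n inj m by auto
  ultimately show False by (rule no_swirl[OF c])
qed

lemma cfg_corner_right:
  assumes c: "cfg r I F G"
  shows "F (0, 3) = G (4, 0)"
  using cfg_corner[OF cfg_reflx[OF c]] by (simp add: reflx_image_eq flop_def flip_def)

text \<open>With the corners settled, \<open>G (1, 0)\<close> and \<open>G (3, 0)\<close> must be
  the two middle boxes of the bottom row, which leaves only the middle of the second row for
  \<open>G (2, 0)\<close>.\<close>

lemma cfg_middle:
  assumes c: "cfg r I F G"
  shows "F (1, 2) = G (2, 0)"
proof -
  have i: "(0, 0) \<in> Idx" "(0, 1) \<in> Idx" "(0, 2) \<in> Idx" "(0, 3) \<in> Idx" "(1, 1) \<in> Idx" "(1, 3) \<in> Idx"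
    "(1, 0) \<in> Idx" "(2, 0) \<in> Idx" "(3, 0) \<in> Idx" "(4, 0) \<in> Idx" "(3, 1) \<in> Idx" by (simp_all add: Idx_def)
  note inj = cfg_inj[OF c]
  have cand: "G (1, 0) \<in> {F (0, 0), F (0, 1), F (1, 1)}" "G (3, 0) \<in> {F (0, 2), F (0, 3), F (1, 3)}"
    "G (2, 0) \<in> {F (0, 1), F (0, 2), F (1, 2)}"
    using cfg_candidates(5,9,8)[OF cfg_swap[OF c]] by (simp_all add: swap_image_eq)
  have a1: "G (1, 0) = F (0, 1)" using cand(1) inj i unfolding cfg_corner[OF c] cfg_common(1)[OF c] by auto
  have a2: "G (3, 0) = F (0, 2)" using cand(2) inj i unfolding cfg_corner_right[OF c] cfg_common(2)[OF c] by auto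
  have "G (2, 0) = F (1, 2)" using cand(3) inj i unfolding a1[symmetric] a2[symmetric] by simp
  then show ?thesis by simp
qed

lemma cfg_middle_left:
  assumes c: "cfg r I F G"
  shows "F (2, 0) = G (1, 2)"
  using cfg_middle[OF cfg_swap[OF c]] by (simp add: swap_image_eq)

lemma cfg_middle_right:
  assumes c: "cfg r I F G"
  shows "F (2, 3) = G (3, 2)"
  using cfg_middle_left[OF cfg_reflx[OF c]] by (simp add: reflx_image_eq flop_def flip_def)

section \<open>The four central boxes\<close>

lemma centre_c2C2:
  assumes c: "cfg r I F G" and e: "F (2, 1) = G (2, 1)"
  shows "(5/2, 5/2) \<in> F (2, 1)"
proof (rule box_c2C2)
  have i: "(2, 1) \<in> Idx" "(1, 2) \<in> Idx" by (simp_all add: Idx_def)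
  note d = cfg_disjoint[OF c] and I = cfg_in_I[OF c] and inj = cfg_inj[OF c]
  show "is_box r (F (2, 1))" using cfg_box[OF c] i by simp
  show "(2, 2273/1000) \<in> F (2, 1)" by (rule cfg_row[OF c, of "541/1000" 0]) (simp_all add: Idx_def pt_def)
  show "(2, 2727/1000) \<in> F (2, 1)" by (rule cfg_row[OF c, of "995/1000" 0]) (simp_all add: Idx_def pt_def)
  show "(2273/1000, 2) \<in> F (2, 1)" unfolding e by (rule cfg_column[OF c, of "541/1000" 0]) (simp_all add: Idx_def pt_def)
  show "(2727/1000, 2) \<in> F (2, 1)" unfolding e by (rule cfg_column[OF c, of "995/1000" 0]) (simp_all add: Idx_def pt_def)
  have "(5/2, 1861/1000) \<in> F (1, 2)" by (rule cfg_row[OF c, of "995/1000" 0]) (simp_all add: Idx_def pt_def)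
  then show "(5/2, 1861/1000) \<notin> F (2, 1)" using d[of "F (1, 2)" "F (2, 1)"] I inj(1)[of "(1, 2)" "(2, 1)"] i by auto
  have "(1861/1000, 5/2) \<in> G (1, 2)" by (rule cfg_column[OF c, of "995/1000" 0]) (simp_all add: Idx_def pt_def)
  then show "(1861/1000, 5/2) \<notin> F (2, 1)"
    unfolding e using d[of "G (1, 2)" "G (2, 1)"] I inj(2)[of "(1, 2)" "(2, 1)"] i by auto
qed

lemma centre_clash:
  assumes c: "cfg r I F G" and e: "F (2, 1) = G (2, 1)" "F (2, 2) = G (2, 2)"
  shows False
proof -
  have i: "(2, 1) \<in> Idx" "(2, 2) \<in> Idx" by (simp_all add: Idx_def)
  \<comment> \<open>Swap followed by reflection is a quarter turn; done twice it is the half turn,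
    which exchanges the labels \<open>(2, 1)\<close> and \<open>(2, 2)\<close>.\<close>
  note c' = cfg_reflx[OF cfg_swap[OF cfg_reflx[OF cfg_swap[OF c]]]]
  have "(5/2, 5/2) \<in> F (2, 2)"
    using centre_c2C2[OF c'] e by (simp add: flop_def flip_def mem_reflx_image mem_swap_image)
  then have "F (2, 1) = F (2, 2)"
    using cfg_disjoint[OF c] cfg_in_I[OF c] centre_c2C2[OF c e(1)] i by blast
  then show False using cfg_inj(1)[OF c i] by simp
qed

theorem no_disjoint_boxes: "\<not> disjoint_boxes r I"
proof
  assume "disjoint_boxes r I"
  then obtain F G where c: "cfg r I F G" using exists_cfg by blast
  have i: "(2, 1) \<in> Idx" "(2, 2) \<in> Idx" "(1, 1) \<in> Idx" "(1, 3) \<in> Idx" "(3, 1) \<in> Idx" "(3, 3) \<in> Idx" "(2, 0) \<in> Idx" "(2, 3) \<in> Idx"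
    by (simp_all add: Idx_def)
  note inj = cfg_inj(1)[OF c]
  \<comment> \<open>These boxes already carry both labels; this strikes out all but two candidates
    for each of the two central boxes.\<close>
  note m = cfg_common[OF c, symmetric] cfg_middle_left[OF c, symmetric] cfg_middle_right[OF c, symmetric]
  have "F (2, 1) \<in> {G (2, 1), G (2, 2)}" "F (2, 2) \<in> {G (2, 1), G (2, 2)}"
    using cfg_candidates(10,11)[OF c] inj i unfolding m by auto
  moreover have "F (2, 1) \<noteq> F (2, 2)" using inj i by simp
  ultimately consider "F (2, 1) = G (2, 1)" "F (2, 2) = G (2, 2)" | "F (2, 1) = G (2, 2)" "F (2, 2) = G (2, 1)" by auto
  then show False
  proof cases
    case 1
    then show False by (rule centre_clash[OF c])
  next
    case 2
    \<comment> \<open>\<open>flop\<close> exchanges \<open>(2, 1)\<close> and \<open>(2, 2)\<close>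
      while \<open>flip\<close> fixes both, so the reflection turns the crossed pairing into the
      straight one.\<close>
    then show False by (intro centre_clash[OF cfg_reflx[OF c]]) (simp_all add: flop_def flip_def)
  qed
qed

section \<open>From packings to boxes\<close>

lemma orthonormal_pair:
  fixes a b c d :: real
  assumes "a * a + b * b = 1" "c * c + d * d = 1" "a * c + b * d = 0"
  shows "c = - b \<and> d = a \<or> c = b \<and> d = - a"
proof -
  define e where "e = a * d - b * c"
  have "c = (a * a + b * b) * c - a * (a * c + b * d)" "d = (a * a + b * b) * d - b * (a * c + b * d)" using assms by simp_all
  then have cd: "c = - e * b" "d = e * a" unfolding e_def by (simp_all add: algebra_simps)
  have "e * e * (a * a + b * b) = c * c + d * d" unfolding cd by (simp add: algebra_simps)
  then have "e = 1 \<or> e = - 1" using assms by (simp add: square_eq_1_iff)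
  then show ?thesis using cd by auto
qed

lemma orthonormal_inner:
  assumes "orthonormal u v"
  shows "u \<bullet> u = 1" "v \<bullet> v = 1" "u \<bullet> v = 0" "v \<bullet> u = 0"
  using assms by (auto simp: orthonormal_def norm_eq_1 inner_commute)

lemma orthonormal_expand:
  fixes z :: "real ^ 2"
  assumes "orthonormal u v"
  shows "z = (z \<bullet> u) *\<^sub>R u + (z \<bullet> v) *\<^sub>R v"
proof -
  have "v $ 1 = - (u $ 2) \<and> v $ 2 = u $ 1 \<or> v $ 1 = u $ 2 \<and> v $ 2 = - (u $ 1)"
    by (rule orthonormal_pair) (use orthonormal_inner[OF assms] in \<open>simp_all add: inner_vec_def sum_2\<close>)
  moreover have uu: "u $ 1 * u $ 1 + u $ 2 * u $ 2 = 1" using orthonormal_inner[OF assms] by (simp add: inner_vec_def sum_2)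
  have "(z $ 1 * u $ 1 + z $ 2 * u $ 2) * u $ 1 + (z $ 2 * u $ 1 - z $ 1 * u $ 2) * (- u $ 2) = z $ 1 * (u $ 1 * u $ 1 + u $ 2 * u $ 2)"
    "(z $ 1 * u $ 1 + z $ 2 * u $ 2) * u $ 2 + (z $ 2 * u $ 1 - z $ 1 * u $ 2) * u $ 1 = z $ 2 * (u $ 1 * u $ 1 + u $ 2 * u $ 2)"
    by (simp_all add: algebra_simps)
  note this[unfolded uu]
  ultimately show ?thesis by (auto simp: vec_eq_iff forall_2 inner_vec_def sum_2 algebra_simps)
qed

lemma inner_frame:
  assumes "orthonormal u v"
  shows "(x *\<^sub>R u + y *\<^sub>R v) \<bullet> u = x" "(x *\<^sub>R u + y *\<^sub>R v) \<bullet> v = y"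
  using orthonormal_inner[OF assms] by (simp_all add: inner_add_left)

lemma mem_frame_square:
  assumes "orthonormal u v"
  shows "z \<in> frame_square c u v a \<longleftrightarrow> (z - c) \<bullet> u \<in> {0..a} \<and> (z - c) \<bullet> v \<in> {0..a}"
proof
  assume "z \<in> frame_square c u v a"
  then obtain x y where z: "z - c = x *\<^sub>R u + y *\<^sub>R v" and "x \<in> {0..a}" "y \<in> {0..a}"
    by (auto simp: frame_square_def)
  then show "(z - c) \<bullet> u \<in> {0..a} \<and> (z - c) \<bullet> v \<in> {0..a}" unfolding z inner_frame[OF assms] by simp
next
  assume *: "(z - c) \<bullet> u \<in> {0..a} \<and> (z - c) \<bullet> v \<in> {0..a}"
  have "z = c + ((z - c) \<bullet> u) *\<^sub>R u + ((z - c) \<bullet> v) *\<^sub>R v"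
    using orthonormal_expand[OF assms, of "z - c"] by (simp add: algebra_simps)
  then show "z \<in> frame_square c u v a" unfolding frame_square_def using * by blast
qed

lemma interior_frame_square:
  assumes o: "orthonormal u v"
  shows "interior (frame_square c u v a) = {z. (z - c) \<bullet> u \<in> {0<..<a} \<and> (z - c) \<bullet> v \<in> {0<..<a}}"
proof
  have "open {z. 0 < (z - c) \<bullet> u \<and> (z - c) \<bullet> u < a \<and> 0 < (z - c) \<bullet> v \<and> (z - c) \<bullet> v < a}"
    by (intro open_Collect_conj open_Collect_less continuous_intros)
  then show "{z. (z - c) \<bullet> u \<in> {0<..<a} \<and> (z - c) \<bullet> v \<in> {0<..<a}} \<subseteq> interior (frame_square c u v a)"
    by (intro interior_maximal) (auto simp: mem_frame_square[OF o])
  show "interior (frame_square c u v a) \<subseteq> {z. (z - c) \<bullet> u \<in> {0<..<a} \<and> (z - c) \<bullet> v \<in> {0<..<a}}"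
  proof
    fix z
    assume "z \<in> interior (frame_square c u v a)"
    then obtain e where e: "0 < e" "ball z e \<subseteq> frame_square c u v a" by (auto simp: mem_interior)
    have n: "norm u = 1" "norm v = 1" using o by (simp_all add: orthonormal_def)
    have m: "z + t *\<^sub>R w \<in> frame_square c u v a" if "\<bar>t\<bar> < e" "norm w = 1" for t w
      using e(2) that by (auto simp: dist_norm subset_iff)
    have "z + (e/2) *\<^sub>R u \<in> frame_square c u v a" "z + (- e/2) *\<^sub>R u \<in> frame_square c u v a"
      "z + (e/2) *\<^sub>R v \<in> frame_square c u v a" "z + (- e/2) *\<^sub>R v \<in> frame_square c u v a"
      by (rule m; use e n in simp)+
    then show "z \<in> {z. (z - c) \<bullet> u \<in> {0<..<a} \<and> (z - c) \<bullet> v \<in> {0<..<a}}"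
      using e(1) orthonormal_inner[OF o] by (simp add: mem_frame_square[OF o] inner_add_left inner_diff_left)
  qed
qed

lemma is_boxI_nonneg:
  assumes "1 < r" "r < 1001/1000" "0 \<le> c" "0 \<le> s" "c * c + s * s = 1"
    and B: "\<And>a b. k \<le> a * c + b * s \<Longrightarrow> a * c + b * s \<le> k + r \<Longrightarrow> m \<le> b * c - a * s \<Longrightarrow> b * c - a * s \<le> m + r \<Longrightarrow>
      0 \<le> a \<and> a \<le> 5 \<and> 0 \<le> b \<and> b \<le> 5"
  shows "is_box r {(a, b). inb r c s k m a b}"
proof -
  have e: "(K * c - M * s) * c + (K * s + M * c) * s = K" "(K * s + M * c) * c - (K * c - M * s) * s = M" for K M
  proof -
    have "(K * c - M * s) * c + (K * s + M * c) * s = K * (c * c + s * s)"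
      "(K * s + M * c) * c - (K * c - M * s) * s = M * (c * c + s * s)" by (simp_all add: algebra_simps)
    then show "(K * c - M * s) * c + (K * s + M * c) * s = K" "(K * s + M * c) * c - (K * c - M * s) * s = M"
      using assms(5) by simp_all
  qed
  have "0 \<le> K * c - M * s \<and> K * c - M * s \<le> 5 \<and> 0 \<le> K * s + M * c \<and> K * s + M * c \<le> 5"
    if "k \<le> K" "K \<le> k + r" "m \<le> M" "M \<le> m + r" for K M
    by (rule B; use that in \<open>simp only: e\<close>)
  \<comment> \<open>The left, right, bottom and top vertex, in this order.\<close>
  from this[of k "m + r"] this[of "k + r" m] this[of k m] this[of "k + r" "m + r"]
  have "fitting r c s k m" using assms by (simp add: fitting_def)
  then show ?thesis unfolding is_box_def by blast
qed

text \<open>The same square in the frame turned by 90 degrees; suitable turns bring any direction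
  into the first quadrant.\<close>

lemma inb_quarter_turn: "inb r (- s) c m (- k - r) a b \<longleftrightarrow> inb r c s k m a b"
  by (auto simp: inb_def algebra_simps)

lemma is_boxI:
  assumes r: "1 < r" "r < 1001/1000" and cs: "c * c + s * s = 1"
    and B: "\<And>a b. k \<le> a * c + b * s \<Longrightarrow> a * c + b * s \<le> k + r \<Longrightarrow> m \<le> b * c - a * s \<Longrightarrow> b * c - a * s \<le> m + r \<Longrightarrow>
      0 \<le> a \<and> a \<le> 5 \<and> 0 \<le> b \<and> b \<le> 5"
  shows "is_box r {(a, b). inb r c s k m a b}"
proof -
  consider "0 \<le> c" "0 \<le> s" | "0 \<le> c" "s \<le> 0" | "c \<le> 0" "s \<le> 0" | "c \<le> 0" "0 \<le> s" by linarith
  then show ?thesis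
  proof cases
    case 1
    then show ?thesis using is_boxI_nonneg[OF r _ _ cs B] by blast
  next
    case 2
    have "is_box r {(a, b). inb r (- s) c m (- k - r) a b}"
      by (rule is_boxI_nonneg[OF r]; (rule B)?) (use 2 cs in \<open>auto simp: algebra_simps\<close>)
    then show ?thesis by (simp only: inb_quarter_turn)
  next
    case 3
    have "is_box r {(a, b). inb r (- c) (- s) (- k - r) (- m - r) a b}"
      by (rule is_boxI_nonneg[OF r]; (rule B)?) (use 3 cs in \<open>auto simp: algebra_simps\<close>)
    then show ?thesis by (simp only: inb_quarter_turn[of r s "- c", simplified] inb_quarter_turn)
  next
    case 4
    have "is_box r {(a, b). inb r s (- c) (- m - r) k a b}"
      by (rule is_boxI_nonneg[OF r]; (rule B)?) (use 4 cs in \<open>auto simp: algebra_simps\<close>)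
    moreover have "inb r s (- c) (- m - r) k a b \<longleftrightarrow> inb r c s k m a b" for a b by (auto simp: inb_def algebra_simps)
    ultimately show ?thesis by simp
  qed
qed

text \<open>The map reads coordinates in the frame of the container, scaled by \<open>r\<close>: the
  container becomes the square of side 5 and unit squares get side \<open>r\<close>. The two final
  cases are the two orientations of \<open>(u', v')\<close> relative to \<open>(u, v)\<close>; if
  they are opposite, the second frame interval is negated.\<close>

lemma is_box_frame_square:
  assumes o: "orthonormal u v" and o': "orthonormal u' v'" and r: "1 < r" "r < 1001/1000"
    and sub: "frame_square c' u' v' 1 \<subseteq> frame_square c u v (5 / r)"
  shows "is_box r ((\<lambda>(a, b). c + (a / r) *\<^sub>R u + (b / r) *\<^sub>R v) -` interior (frame_square c' u' v' 1))" (is "is_box r (?T -` _)")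
proof -
  define \<alpha> \<beta> \<gamma> \<delta> where d: "\<alpha> = u \<bullet> u'" "\<beta> = v \<bullet> u'" "\<gamma> = u \<bullet> v'" "\<delta> = v \<bullet> v'"
  define K M where KM: "K = r * ((c' - c) \<bullet> u')" "M = r * ((c' - c) \<bullet> v')"
  have "z \<bullet> w = (z \<bullet> u) * (w \<bullet> u) + (z \<bullet> v) * (w \<bullet> v)" for z w :: "real ^ 2"
  proof -
    have "z \<bullet> w = ((z \<bullet> u) *\<^sub>R u + (z \<bullet> v) *\<^sub>R v) \<bullet> w" by (rule arg_cong[where f = "\<lambda>x. x \<bullet> w", OF orthonormal_expand[OF o]])
    then show ?thesis by (simp only: inner_add_left inner_scaleR_left) (simp add: inner_commute)
  qed
  from this[of u' u'] this[of v' v'] this[of u' v']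
  have ab: "\<alpha> * \<alpha> + \<beta> * \<beta> = 1" and cd: "\<gamma> * \<gamma> + \<delta> * \<delta> = 1" "\<alpha> * \<gamma> + \<beta> * \<delta> = 0"
    using orthonormal_inner[OF o'] by (simp_all add: d inner_commute)
  have U: "(?T (a, b) - c') \<bullet> u' = (a * \<alpha> + b * \<beta> - K) / r" "(?T (a, b) - c') \<bullet> v' = (a * \<gamma> + b * \<delta> - M) / r" for a b
    using r by (simp_all add: d KM inner_add_left inner_diff_left field_simps)
  have inside: "0 \<le> a \<and> a \<le> 5 \<and> 0 \<le> b \<and> b \<le> 5" if "K \<le> a * \<alpha> + b * \<beta>" "a * \<alpha> + b * \<beta> \<le> K + r" "M \<le> a * \<gamma> + b * \<delta>" "a * \<gamma> + b * \<delta> \<le> M + r" for a b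
  proof -
    have "?T (a, b) \<in> frame_square c' u' v' 1" unfolding mem_frame_square[OF o'] U using that r by simp
    then have "?T (a, b) \<in> frame_square c u v (5 / r)" using sub by blast
    moreover have "?T (a, b) - c = (a / r) *\<^sub>R u + (b / r) *\<^sub>R v" by simp
    ultimately have "a / r \<in> {0..5 / r}" "b / r \<in> {0..5 / r}" unfolding mem_frame_square[OF o] by (simp_all only: inner_frame[OF o])
    then show ?thesis using r by (simp add: field_simps)
  qed
  have B: "(a, b) \<in> ?T -` interior (frame_square c' u' v' 1) \<longleftrightarrow>
      K < a * \<alpha> + b * \<beta> \<and> a * \<alpha> + b * \<beta> < K + r \<and> M < a * \<gamma> + b * \<delta> \<and> a * \<gamma> + b * \<delta> < M + r" for a b
    unfolding interior_frame_square[OF o'] vimage_eq mem_Collect_eq U using r by (auto simp: field_simps)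
  from orthonormal_pair[OF ab cd] show ?thesis
  proof
    assume e: "\<gamma> = - \<beta> \<and> \<delta> = \<alpha>"
    have "?T -` interior (frame_square c' u' v' 1) = {(a, b). inb r \<alpha> \<beta> K M a b}"
      using B e by (auto simp: inb_def algebra_simps)
    moreover have "is_box r {(a, b). inb r \<alpha> \<beta> K M a b}"
      by (rule is_boxI[OF r ab], rule inside) (use e in \<open>auto simp: algebra_simps\<close>)
    ultimately show ?thesis by simp
  next
    assume e: "\<gamma> = \<beta> \<and> \<delta> = - \<alpha>"
    have "?T -` interior (frame_square c' u' v' 1) = {(a, b). inb r \<alpha> \<beta> K (- M - r) a b}"
      using B e by (auto simp: inb_def algebra_simps)
    moreover have "is_box r {(a, b). inb r \<alpha> \<beta> K (- M - r) a b}"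
      by (rule is_boxI[OF r ab], rule inside) (use e in \<open>auto simp: algebra_simps\<close>)
    ultimately show ?thesis by simp
  qed
qed

lemma frame_square_mono: "a \<le> b \<Longrightarrow> frame_square c u v a \<subseteq> frame_square c u v b"
  by (force simp: frame_square_def)

lemma not_packable_22:
  assumes "b < 5"
  shows "\<not> packable 22 b"
proof
  assume "packable 22 b"
  then obtain c u v \<Q> where o: "orthonormal u v" and p: "packing 22 \<Q> (frame_square c u v b)"
    by (auto simp: packable_def is_square_def)
  \<comment> \<open>Enlarging a small container to side \<open>4999/1000\<close> keeps the scaling
    factor \<open>r\<close> below \<open>1001/1000\<close>.\<close>
  define b' where "b' = max b (4999/1000)"
  define r where "r = 5 / b'"
  have b': "b \<le> b'" "b' < 5" "4999/1000 \<le> b'" using assms by (auto simp: b'_def)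
  have r: "1 < r" "r < 1001/1000" "5 / r = b'" using b' by (auto simp: r_def field_simps)
  define T where "T = (\<lambda>(a, b). c + (a / r) *\<^sub>R u + (b / r) *\<^sub>R v)"
  define J where "J Q = T -` interior Q" for Q
  have box: "is_box r (J Q) \<and> J Q \<noteq> {}" if Q: "Q \<in> \<Q>" for Q
  proof -
    obtain c' u' v' where o': "orthonormal u' v'" and Qe: "Q = frame_square c' u' v' 1" and sub: "Q \<subseteq> frame_square c u v b"
      using p Q by (auto simp: packing_def is_square_def)
    have "frame_square c' u' v' 1 \<subseteq> frame_square c u v (5 / r)" using sub frame_square_mono[OF b'(1), of c u v] unfolding Qe r(3) by (rule subset_trans)
    then have "is_box r (J Q)" using is_box_frame_square[OF o o' r(1,2)] unfolding J_def T_def Qe by simp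
    moreover define z where "z = c' + ((1/2) *\<^sub>R u' + (1/2) *\<^sub>R v')"
    have "z \<in> interior Q" unfolding Qe interior_frame_square[OF o'] z_def by (simp only: mem_Collect_eq add_diff_cancel_left' inner_frame[OF o']) simp
    moreover have "r * x / r = x" for x using r by simp
    then have "T (r * ((z - c) \<bullet> u), r * ((z - c) \<bullet> v)) = z"
      by (simp only: T_def prod.case add.assoc orthonormal_expand[OF o, of "z - c", symmetric]) simp
    ultimately show ?thesis unfolding J_def by blast
  qed
  have dis: "J P \<inter> J Q = {}" if "P \<in> \<Q>" "Q \<in> \<Q>" "P \<noteq> Q" for P Q
    using p that unfolding packing_def pairwise_def J_def by blast
  have "inj_on J \<Q>" using box dis by (metis inf.idem inj_onI)
  then have "card (J ` \<Q>) = 22" using p by (simp add: card_image packing_def)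
  moreover have "finite (J ` \<Q>)" using p by (simp add: packing_def)
  ultimately have "disjoint_boxes r (J ` \<Q>)" unfolding disjoint_boxes_def using box dis by blast
  then show False using no_disjoint_boxes by blast
qed

section \<open>The trivial packing is a packing\<close>

lemma mem_grid_cell:
  assumes o: "orthonormal u v"
  shows "z \<in> frame_square (c + real i *\<^sub>R u + real j *\<^sub>R v) u v 1 \<longleftrightarrow>
    (z - c) \<bullet> u \<in> {real i..real i + 1} \<and> (z - c) \<bullet> v \<in> {real j..real j + 1}"
  unfolding mem_frame_square[OF o]
  using orthonormal_inner[OF o] by (auto simp: inner_diff_left inner_add_left algebra_simps)

lemma interior_grid_cell:
  assumes o: "orthonormal u v"
  shows "interior (frame_square (c + real i *\<^sub>R u + real j *\<^sub>R v) u v 1) =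
    {z. (z - c) \<bullet> u \<in> {real i<..<real i + 1} \<and> (z - c) \<bullet> v \<in> {real j<..<real j + 1}}"
  unfolding interior_frame_square[OF o]
  using orthonormal_inner[OF o] by (auto simp: inner_diff_left inner_add_left algebra_simps)

lemma interior_grid_cell_disjoint:
  assumes o: "orthonormal u v" and "(i, j) \<noteq> (i', j')"
  shows "interior (frame_square (c + real i *\<^sub>R u + real j *\<^sub>R v) u v 1) \<inter>
    interior (frame_square (c + real i' *\<^sub>R u + real j' *\<^sub>R v) u v 1) = {}"
proof -
  have "i < i' \<or> i' < i \<or> j < j' \<or> j' < j" using assms(2) by auto
  then have "real i + 1 \<le> real i' \<or> real i' + 1 \<le> real i \<or> real j + 1 \<le> real j' \<or> real j' + 1 \<le> real j" by linarith
  then show ?thesis unfolding interior_grid_cell[OF o] by auto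
qed

lemma card_grid_cells:
  assumes o: "orthonormal u v"
  shows "finite (grid_cells k c u v)" "card (grid_cells k c u v) = k * k"
proof -
  let ?f = "\<lambda>(i, j). frame_square (c + real i *\<^sub>R u + real j *\<^sub>R v) u v 1"
  have eq: "grid_cells k c u v = ?f ` ({..<k} \<times> {..<k})" by (auto simp: grid_cells_def image_iff)
  have ne: "interior (?f (i, j)) \<noteq> {}" for i j
  proof -
    have "c + ((real i + 1/2) *\<^sub>R u + (real j + 1/2) *\<^sub>R v) \<in> interior (?f (i, j))"
      unfolding prod.case interior_grid_cell[OF o] by (simp only: mem_Collect_eq add_diff_cancel_left' inner_frame[OF o]) simp
    then show ?thesis by blast
  qed
  have "inj_on ?f ({..<k} \<times> {..<k})"
  proof (rule inj_onI)
    fix x y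
    assume "?f x = ?f y"
    then show "x = y" using interior_grid_cell_disjoint[OF o, of "fst x" "snd x" "fst y" "snd y" c] ne[of "fst x" "snd x"]
      by (auto simp: case_prod_unfold)
  qed
  then show "finite (grid_cells k c u v)" "card (grid_cells k c u v) = k * k"
    unfolding eq by (simp_all add: card_image card_cartesian_product)
qed

lemma trivial_packing_is_packing:
  assumes t: "trivial_packing n k \<Q> S" and k: "0 < k"
  shows "is_square (real k) S" "packing n \<Q> S"
proof -
  obtain c u v where o: "orthonormal u v" and S: "S = frame_square c u v (real k)"
    and Q: "\<Q> \<subseteq> grid_cells k c u v" "finite \<Q>" "card \<Q> = n"
    using t by (auto simp: trivial_packing_def)
  show "is_square (real k) S" using o S k by (auto simp: is_square_def)
  have cell: "is_square 1 P \<and> P \<subseteq> S" if P: "P \<in> \<Q>" for P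
  proof -
    obtain i j where P: "P = frame_square (c + real i *\<^sub>R u + real j *\<^sub>R v) u v 1" and ij: "i < k" "j < k"
      using Q(1) P by (auto simp: grid_cells_def)
    have "real i + 1 \<le> real k" "real j + 1 \<le> real k" using ij by linarith+
    then have "P \<subseteq> S" unfolding P S subset_iff mem_grid_cell[OF o] unfolding mem_frame_square[OF o] by auto
    then show ?thesis using o P by (auto simp: is_square_def)
  qed
  have "pairwise (\<lambda>P Q. interior P \<inter> interior Q = {}) \<Q>"
  proof (rule pairwiseI)
    fix P P'
    assume P: "P \<in> \<Q>" "P' \<in> \<Q>" "P \<noteq> P'"
    obtain i j where "P = frame_square (c + real i *\<^sub>R u + real j *\<^sub>R v) u v 1" using Q(1) P(1) unfolding grid_cells_def by blast
    moreover obtain i' j' where "P' = frame_square (c + real i' *\<^sub>R u + real j' *\<^sub>R v) u v 1" using Q(1) P(2) unfolding grid_cells_def by blast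
    moreover have "(i, j) \<noteq> (i', j')" using calculation P(3) by auto
    ultimately show "interior P \<inter> interior P' = {}" using interior_grid_cell_disjoint[OF o] by blast
  qed
  then show "packing n \<Q> S" using Q cell by (simp add: packing_def)
qed

lemma exists_trivial_packing:
  assumes "n \<le> k * k"
  shows "\<exists>\<Q> S. trivial_packing n k \<Q> S"
proof -
  have o: "orthonormal (axis 1 1) (axis 2 1)" by (simp add: orthonormal_def inner_axis_axis)
  obtain \<Q> where "\<Q> \<subseteq> grid_cells k 0 (axis 1 1) (axis 2 1)" "card \<Q> = n" "finite \<Q>"
    using obtain_subset_with_card_n[of n "grid_cells k 0 (axis 1 1) (axis 2 1)"] assms card_grid_cells(2)[OF o] by metis
  then show ?thesis unfolding trivial_packing_def using o by blast
qed

theorem corollary12: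
  "(\<exists>\<Q> S. trivial_packing 22 5 \<Q> S) \<and>
   (\<forall>\<Q> S. trivial_packing 22 5 \<Q> S \<longrightarrow> optimal_packing 22 5 \<Q> S) \<and>
   packing_side 22 = 5"
proof (intro conjI allI impI)
  show ex: "\<exists>\<Q> S. trivial_packing 22 5 \<Q> S" by (rule exists_trivial_packing) simp
  have p: "is_square 5 S \<and> packing 22 \<Q> S" if "trivial_packing 22 5 \<Q> S" for \<Q> S
    using trivial_packing_is_packing[OF that] by simp
  then show "optimal_packing 22 5 \<Q> S" if "trivial_packing 22 5 \<Q> S" for \<Q> S
    using that not_packable_22 by (simp add: optimal_packing_def)
  show "packing_side 22 = 5" unfolding packing_side_def
  proof (rule Least_equality)
    show "packable 22 5" using ex p unfolding packable_def by blast
    show "5 \<le> b" if "packable 22 b" for b using that not_packable_22 by (meson not_less)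
  qed
qed

end
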